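(* Let $\beta\in[0,1)$ and let $f_\beta(x)=\sum_{i=0}^\infty c_i x^i$ be the unique analytic solution with $f_\beta(0)=1$ of $$\int_0^\infty \frac{f_\beta(sx)}{f_\beta(x)}\,dx=\frac{1}{1-s}-\beta\qquad\text{for all } s\in[0,1).$$ Then the limit $$\omega(\beta)=\lim_{x\to\infty}\frac{\log f_\beta(x)-x}{\log x}$$ exists (and is finite).
   Context: Existence and uniqueness of such an $f_\beta$ (with $f_\beta(0)=1$) is known; $f_\beta$ is the function encoding the $(\beta,1)$-balanced embedding of the complex plane with divisor the origin into a projective Hilbert space. *)

theory Defs
  imports "HOL-Analysis.Analysis"
begin

end

theory Submission
  imports Defs
begin

text \<open>
  The limit is $\beta$; in fact $\log f(x) = x + \beta \log x + O(1)$.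

  Let $p_i(x) = c_i x^i / f(x)$. Comparing coefficients of $s^i$ gives
  $\int_0^\infty p_i = 1$ for $i \ge 1$ and $\int_0^\infty p_0 = 1 - \beta$. This needs no sign
  assumption: $f > 0$ because $1 / f$ is integrable, and then the primitive of $f$ grows fast enough
  to dominate Taylor remainders. In particular all $c_i$ are positive.

  Put $m(x) = x f'(x) / f(x)$ and $r_i = c_{i-1} / c_i$, $r_0 = 0$. Averaging over $i$ with weights
  $p_i(x)$ maps $i$ to $m(x)$ and $r_i$ to $x$; averaging over $x$ with density $p_i$ maps $m$ to
  $i + 1$ (by parts) and $x$ to $r_{i+1}$. So $r_n$ and $n$ are both harmonic for a shifted averaging
  operator, up to a boundary term at $i = 0$. Convexity of $\log f$ in $\log x$ gives
  $\int_0^\infty e^{-\lambda m(x)} dx \sim 1 / \lambda$, hence $m(x) \sim x$ by Karamata's Tauberian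
  theorem and $r_n \sim n$, which is what a maximum principle needs to yield $n - 1 \le r_n \le n$,
  that is $x \le m(x) \le x + 1$.

  Finally let $g(x) = \log f(x) - x$, so that $0 \le x g'(x) \le 1$. For $s = 1 - 1/n$ the functional
  equation reads $\int_0^\infty e^{-v} e^{-(g(nv) - g((n-1)v))} dv = 1 - \beta / n$, so the
  exponential means $B(n) = \int_0^\infty e^{-v} g(nv) dv$ satisfy
  $B(n) - B(n-1) = \beta / n + O(1 / n^2)$, and $g(n) - B(n)$ is bounded.
\<close>

subsection \<open>Positivity of the solution\<close>

text \<open>The series converges on the whole line here, so that power series calculus is available
  at 0 too. A function given on the half-line is first replaced by the sum of its series.\<close>

locale balanced_series =
  fixes \<beta> :: real and c :: "nat \<Rightarrow> real" and f :: "real \<Rightarrow> real"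
  assumes beta: "0 \<le> \<beta>" "\<beta> < 1"
    and series: "\<And>x. (\<lambda>i. c i * x ^ i) sums f x"
    and f0: "f 0 = 1"
    and inteq: "\<And>s. 0 \<le> s \<Longrightarrow> s < 1 \<Longrightarrow>
       ((\<lambda>x. f (s * x) / f x) has_integral (1 / (1 - s) - \<beta>)) {0..}"
begin

section \<open>Power series calculus for \<open>f\<close>\<close>

lemma summable_c: "summable (\<lambda>i. c i * x ^ i)"
  using series sums_summable by blast

lemma f_eq: "f x = (\<Sum>i. c i * x ^ i)"
  using series sums_unique by blast

lemma c_0: "c 0 = 1"
  using powser_sums_zero_iff[of c 1] series[of 0] f0 by (simp add: powser_sums_zero_iff)

definition f' where "f' x = (\<Sum>i. diffs c i * x ^ i)"

lemma DERIV_f: "(f has_real_derivative f' x) (at x)"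
  using termdiffs_strong_converges_everywhere[OF summable_c, of x]
  unfolding f'_def f_eq[abs_def] .

lemma summable_diffs_c: "summable (\<lambda>i. diffs c i * x ^ i)"
  by (rule termdiff_converges_all) (rule summable_c)

lemma cont_f': "continuous_on A f'"
  unfolding f'_def using isCont_powser_converges_everywhere[OF summable_diffs_c]
  by (simp add: continuous_at_imp_continuous_on)

lemma cont_f: "continuous_on A f"
  using DERIV_f DERIV_isCont continuous_at_imp_continuous_on by blast

lemma f_measurable [measurable]: "f \<in> borel_measurable borel"
  and f'_measurable [measurable]: "f' \<in> borel_measurable borel"
  using cont_f cont_f' by (auto intro: borel_measurable_continuous_onI)

lemma x_f'_sums: "(\<lambda>i. c i * real i * x ^ i) sums (x * f' x)"
proof -
  have "(\<lambda>i. x * (diffs c i * x ^ i)) sums (x * f' x)"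
    unfolding f'_def by (intro sums_mult summable_sums summable_diffs_c)
  then have "(\<lambda>i. c (Suc i) * real (Suc i) * x ^ Suc i) sums (x * f' x)"
    by (simp add: diffs_def algebra_simps)
  then show ?thesis
    by (subst (asm) sums_Suc_iff) simp
qed

text \<open>At a first zero $x_0$ the function $1/f$ would dominate $1 / (C (x_0 - x))$
  and could not be integrable.\<close>

lemma f_pos:
  assumes "0 \<le> x"
  shows "0 < f x"
proof (rule ccontr)
  assume "\<not> 0 < f x"
  \<comment> \<open>Collecting the points with \<open>f \<le> 0\<close>, not just the zeros, puts
    \<open>x\<close> in \<open>Z\<close> at once; compactness then yields a least element
    \<open>z\<close>.\<close>
  define Z where "Z = {0..x} \<inter> f -` {..0}"
  have "compact Z"
    unfolding Z_def using continuous_on_closed_vimage[of "{0..x}" f] cont_f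
    by (metis closed_atLeastAtMost closed_atMost compact_Icc compact_Int_closed
        continuous_closed_preimage inf.idem inf_assoc)
  moreover have "x \<in> Z"
    using assms \<open>\<not> 0 < f x\<close> by (auto simp: Z_def)
  ultimately obtain z where z: "z \<in> Z" "\<And>y. y \<in> Z \<Longrightarrow> z \<le> y"
    using compact_attains_inf[of Z] by blast
  have fz: "f z \<le> 0" and z_le: "0 \<le> z" "z \<le> x"
    using z(1) by (auto simp: Z_def)
  with f0 have z0: "0 < z"
    by (cases "z = 0") auto
  have pos: "0 < f y" if "0 \<le> y" "y < z" for y
    using z(2)[of y] that z_le by (force simp: Z_def)
  have "bounded (f' ` {0..z})"
    by (intro compact_imp_bounded compact_continuous_image cont_f' compact_Icc)
  then obtain C where C: "C > 0" "\<And>y. y \<in> {0..z} \<Longrightarrow> \<bar>f' y\<bar> \<le> C"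
    unfolding bounded_pos by force
  \<comment> \<open>The mean value theorem with the bound \<open>C\<close> on \<open>f'\<close>:
    approaching \<open>z\<close>, \<open>f\<close> is at most linear in the distance.\<close>
  have f_le: "f y \<le> C * (z - y)" if y: "0 \<le> y" "y < z" for y
  proof -
    obtain t where t: "y < t" "t < z" "f z - f y = (z - y) * f' t"
      using MVT2[OF y(2), of f f'] DERIV_f by auto
    have "- f' t \<le> C"
      using C(2)[of t] t y by auto
    then have "(z - y) * (- f' t) \<le> (z - y) * C"
      using y by (intro mult_left_mono) auto
    then show ?thesis
      using t fz by (simp add: algebra_simps)
  qed
  have int: "((\<lambda>y. 1 / f y) has_integral (1 - \<beta>)) {0..}"
    using inteq[of 0] f0 by simp
  then have int_z: "(\<lambda>y. 1 / f y) integrable_on {0..t}" for t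
    by (intro integrable_on_subinterval[of _ "{0..}"]) auto
  define I where "I = integral {0..z} (\<lambda>y. 1 / f y)"
  \<comment> \<open>Minimality of \<open>z\<close> forces the zero found here to be \<open>z\<close>
    itself. Hence \<open>1 / f z = 1 / 0 = 0\<close>, and the integrand is nonnegative on the closed
    interval.\<close>
  obtain y where y: "0 \<le> y" "y \<le> z" "f y = 0"
    using IVT2'[of f z 0 0] fz f0 z_le cont_f by auto
  then have "z \<le> y"
    using z(2)[of y] z_le by (auto simp: Z_def)
  with y have f_z: "f z = 0"
    by auto
  have le_I: "ln z - ln (z - t) \<le> C * I" if "0 \<le> t" "t < z" for t
  proof -
    have "((\<lambda>y. 1 / (z - y)) has_integral (- ln (z - t) - - ln (z - 0))) {0..t}"
      using that
      by (intro fundamental_theorem_of_calculus)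
         (auto intro!: derivative_eq_intros simp: has_real_derivative_iff_has_vector_derivative[symmetric])
    then have 1: "((\<lambda>y. 1 / (z - y)) has_integral (ln z - ln (z - t))) {0..t}"
      by simp
    have 2: "((\<lambda>y. C * (1 / f y)) has_integral (C * integral {0..t} (\<lambda>y. 1 / f y))) {0..t}"
      by (intro has_integral_mult_right integrable_integral int_z)
    have "ln z - ln (z - t) \<le> C * integral {0..t} (\<lambda>y. 1 / f y)"
    proof (rule has_integral_le[OF 1 2])
      fix y assume y: "y \<in> {0..t}"
      then show "1 / (z - y) \<le> C * (1 / f y)"
        using f_le[of y] pos[of y] that C(1) by (simp add: field_simps)
    qed
    moreover have "integral {0..t} (\<lambda>y. 1 / f y) \<le> I"
      unfolding I_def
    proof (intro integral_subset_le int_z ballI)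
      fix y assume "y \<in> {0..z}"
      then show "0 \<le> 1 / f y"
        using pos[of y] f_z by (cases "y = z") auto
    qed (use that in auto)
    ultimately show ?thesis
      using C(1) by (meson less_imp_le mult_left_mono order_trans)
  qed
  \<comment> \<open>As \<open>t\<close> tends to \<open>z\<close> the left side of
    \<open>le_I\<close> is unbounded, while \<open>C * I\<close> is a fixed number.\<close>
  have "filterlim (\<lambda>t. z - t) (at_right 0) (at_left z)"
    by (auto simp: filterlim_at intro!: tendsto_eq_intros eventually_at_leftI[of 0] z0)
  then have "filterlim (\<lambda>t. ln (z - t)) at_bot (at_left z)"
    by (rule filterlim_compose[OF ln_at_0])
  then have "eventually (\<lambda>t. ln (z - t) < ln z - C * I) (at_left z)"
    by (simp add: filterlim_at_bot_dense)
  moreover have "eventually (\<lambda>t. 0 < t \<and> t < z) (at_left z)"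
    using z0 by (auto intro: eventually_at_leftI[of 0])
  ultimately have "eventually (\<lambda>_. False) (at_left z)"
  proof eventually_elim
    case (elim t)
    then show ?case
      using le_I[of t] by linarith
  qed
  then show False
    by simp
qed

text \<open>Formally comparing coefficients of $s^i$ in the functional equation says that the moments
  of this measure are $1 / c_i$ for $i \ge 1$, and $1 - \beta$ for $i = 0$.\<close>

definition M where "M = density lborel (\<lambda>x. ennreal (indicator {0<..} x / f x))"

lemma weight_nonneg: "0 \<le> indicator {0<..} x / f x"
  using f_pos[of x] by (auto simp: indicator_def)

lemma sets_M [measurable_cong, simp]: "sets M = sets borel"
  by (simp add: M_def)

lemma space_M [simp]: "space M = UNIV"
  by (simp add: M_def)

lemma nn_integral_M:
  "g \<in> borel_measurable borel \<Longrightarrow>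
     (\<integral>\<^sup>+x. g x \<partial>M) = (\<integral>\<^sup>+x. ennreal (indicator {0<..} x / f x) * g x \<partial>lborel)"
  unfolding M_def by (subst nn_integral_density) auto

lemma integrable_M:
  fixes g :: "real \<Rightarrow> real"
  assumes "g \<in> borel_measurable borel"
  shows "integrable M g \<longleftrightarrow> integrable lborel (\<lambda>x. indicator {0<..} x / f x * g x)"
  unfolding M_def using assms weight_nonneg by (subst integrable_density) auto

lemma integral_M:
  fixes g :: "real \<Rightarrow> real"
  assumes "g \<in> borel_measurable borel"
  shows "(LINT x|M. g x) = (LINT x|lborel. indicator {0<..} x / f x * g x)"
  unfolding M_def using assms weight_nonneg by (subst integral_density) auto

lemma AE_M_pos: "AE x in M. 0 < x"
  unfolding M_def by (subst AE_density) (auto simp: indicator_def intro!: AE_I2)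

text \<open>Positivity of \<open>f\<close> turns the gauge integral of the functional equation into
  a Lebesgue integral; dropping the null set {0} makes the domain match the weight of
  \<open>M\<close>.\<close>

lemma nn_integral_M_f:
  assumes s: "0 \<le> s" "s < 1"
  shows "(\<integral>\<^sup>+x. ennreal (f (s * x)) \<partial>M) = ennreal (1 / (1 - s) - \<beta>)"
proof -
  have "((\<lambda>x. f (s * x) / f x) has_integral (1 / (1 - s) - \<beta>)) {0<..}"
  proof (subst has_integral_spike_set_eq)
    show "((\<lambda>x. f (s * x) / f x) has_integral (1 / (1 - s) - \<beta>)) {0..}"
      using inteq[OF s] .
  qed (auto intro: negligible_subset[of "{0}"])
  moreover have "0 \<le> f (s * x) / f x" if "x \<in> {0<..}" for x
    using that s f_pos[of x] f_pos[of "s * x"] by auto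
  ultimately have "(\<integral>\<^sup>+x. ennreal (f (s * x) / f x) * indicator {0<..} x \<partial>lborel)
      = ennreal (1 / (1 - s) - \<beta>)"
    by (intro nn_integral_has_integral_lebesgue') auto
  moreover have "ennreal (indicator {0<..} x / f x) * ennreal (f (s * x))
      = ennreal (f (s * x) / f x) * indicator {0<..} x" for x
    using s f_pos[of x] f_pos[of "s * x"]
    by (auto simp: indicator_def ennreal_mult'[symmetric])
  ultimately show ?thesis
    by (subst nn_integral_M) simp_all
qed

lemma one_minus_beta_le: "0 \<le> s \<Longrightarrow> s < 1 \<Longrightarrow> 1 - \<beta> \<le> 1 / (1 - s) - \<beta>"
  by (simp add: field_simps)

lemma has_bochner_M_f:
  assumes s: "0 \<le> s" "s < 1"
  shows "has_bochner_integral M (\<lambda>x. f (s * x)) (1 / (1 - s) - \<beta>)"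
proof (rule has_bochner_integral_nn_integral)
  show "AE x in M. 0 \<le> f (s * x)"
    using AE_M_pos by eventually_elim (use s f_pos in \<open>simp add: less_imp_le\<close>)
  show "0 \<le> 1 / (1 - s) - \<beta>"
    using one_minus_beta_le[OF s] beta by simp
qed (use nn_integral_M_f[OF s] in auto)

lemma integrable_M_1: "integrable M (\<lambda>x. 1::real)"
  and integral_M_1: "(LINT x|M. (1::real)) = 1 - \<beta>"
  using has_bochner_M_f[of 0] f0 by (simp_all add: has_bochner_integral_iff)

sublocale finite_measure M
proof
  show "emeasure M (space M) \<noteq> \<infinity>"
    using nn_integral_M_f[of 0] f0 by simp
qed

subsection \<open>Moments\<close>

text \<open>\<open>P\<close> below is the primitive of \<open>f\<close> vanishing at 0, and
  \<open>Q\<close> is its quotient by \<open>x\<close>. As the signs of the \<open>c i\<close> are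
  still unknown, \<open>f\<close> itself need not be monotone, but \<open>P\<close> is.\<close>

definition Q where "Q x = (\<Sum>i. c i / real (Suc i) * x ^ i)"

definition P where "P x = x * Q x"

lemma summable_q: "summable (\<lambda>i. c i / real (Suc i) * x ^ i)"
proof (rule summable_comparison_test')
  show "summable (\<lambda>i. norm (c i * x ^ i))"
    by (rule powser_insidea[OF summable_c[of "\<bar>x\<bar> + 1"]]) simp
  show "norm (c i / real (Suc i) * x ^ i) \<le> norm (c i * x ^ i)" if "i \<ge> 0" for i
    by (simp add: abs_mult field_simps mult_left_mono)
qed

lemma Q_sums: "(\<lambda>i. c i / real (Suc i) * x ^ i) sums Q x"
  unfolding Q_def by (intro summable_sums summable_q)

lemma DERIV_P: "(P has_real_derivative f x) (at x)"
proof -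
  define p where "p i = (case i of 0 \<Rightarrow> 0 | Suc j \<Rightarrow> c j / real (Suc j))" for i
  have P_sums: "(\<lambda>i. p i * x ^ i) sums P x" for x
  proof -
    have "(\<lambda>i. x * (c i / real (Suc i) * x ^ i)) sums P x"
      unfolding P_def by (intro sums_mult Q_sums)
    then have "(\<lambda>i. p (Suc i) * x ^ Suc i) sums P x"
      by (simp add: p_def algebra_simps)
    then show ?thesis
      by (subst (asm) sums_Suc_iff) (simp add: p_def)
  qed
  then have P_eq: "P = (\<lambda>x. \<Sum>i. p i * x ^ i)" and sm: "\<And>x. summable (\<lambda>i. p i * x ^ i)"
    by (auto simp: sums_iff)
  have "diffs p = c"
    by (auto simp: diffs_def p_def)
  then show ?thesis
    using termdiffs_strong_converges_everywhere[OF sm, of x] by (simp add: P_eq f_eq)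
qed

lemma P_0 [simp]: "P 0 = 0"
  by (simp add: P_def)

lemma cont_P: "continuous_on A P"
  using DERIV_P DERIV_isCont continuous_at_imp_continuous_on by blast

lemma P_measurable [measurable]: "P \<in> borel_measurable borel"
  using cont_P by (auto intro: borel_measurable_continuous_onI)

lemma P_mono: "0 \<le> x \<Longrightarrow> x \<le> y \<Longrightarrow> P x \<le> P y"
  by (rule DERIV_nonneg_imp_nondecreasing[of x y P])
     (use DERIV_P f_pos in \<open>force intro: less_imp_le\<close>)+

lemma P_pos: "0 < x \<Longrightarrow> 0 < P x"
  using DERIV_pos_imp_increasing[of 0 x P] DERIV_P f_pos by (force intro: less_imp_le)

lemma P_nonneg: "0 \<le> x \<Longrightarrow> 0 \<le> P x"
  using P_mono[of 0 x] by simp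

text \<open>Integrate the functional equation over the dilation parameter \<open>u\<close> in [0, s]
  and exchange the integrals by Tonelli; the inner integral of \<open>f (u * x)\<close> is
  \<open>P (s * x) / x\<close>.\<close>

lemma nn_integral_P:
  assumes s: "0 \<le> s" "s < 1"
  shows "(\<integral>\<^sup>+x. ennreal (P (s * x) / x) \<partial>M) = ennreal (- ln (1 - s) - \<beta> * s)"
proof -
  interpret pair_sigma_finite M lborel ..
  have inner: "(\<integral>\<^sup>+u. ennreal (f (u * x)) * indicator {0..s} u \<partial>lborel) = ennreal (P (s * x) / x)"
    if "0 < x" for x
  proof -
    have "(\<integral>\<^sup>+u. ennreal (f (u * x)) * indicator {0..s} u \<partial>lborel)
        = ennreal (P (s * x) / x - P (0 * x) / x)"
    proof (rule nn_integral_FTC_Icc)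
      fix u assume "u \<in> {0..s}"
      then show "0 \<le> f (u * x)"
        using f_pos[of "u * x"] that by simp
      have "((\<lambda>u. P (u * x) / x) has_real_derivative (f (u * x) * x / x)) (at u)"
        by (rule derivative_eq_intros DERIV_chain2[OF DERIV_P] refl | (use that in simp))+
      then show "((\<lambda>u. P (u * x) / x) has_real_derivative f (u * x)) (at u)"
        using that by simp
    qed (use s in auto)
    then show ?thesis
      by simp
  qed
  have "(\<integral>\<^sup>+x. ennreal (P (s * x) / x) \<partial>M)
      = (\<integral>\<^sup>+x. (\<integral>\<^sup>+u. ennreal (f (u * x)) * indicator {0..s} u \<partial>lborel) \<partial>M)"
    by (rule nn_integral_cong_AE, use AE_M_pos in eventually_elim) (simp add: inner)
  also have "\<dots> = (\<integral>\<^sup>+u. (\<integral>\<^sup>+x. ennreal (f (u * x)) * indicator {0..s} u \<partial>M) \<partial>lborel)"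
    by (rule Fubini'[symmetric]) simp
  also have "\<dots> = (\<integral>\<^sup>+u. ennreal (1 / (1 - u) - \<beta>) * indicator {0..s} u \<partial>lborel)"
  proof (intro nn_integral_cong)
    fix u
    show "(\<integral>\<^sup>+x. ennreal (f (u * x)) * indicator {0..s} u \<partial>M)
        = ennreal (1 / (1 - u) - \<beta>) * indicator {0..s} u"
      using s nn_integral_M_f[of u] by (auto simp: indicator_def)
  qed
  also have "\<dots> = ennreal ((- ln (1 - s) - \<beta> * s) - (- ln (1 - 0) - \<beta> * 0))"
  proof (rule nn_integral_FTC_Icc)
    fix u assume u: "u \<in> {0..s}"
    then show "0 \<le> 1 / (1 - u) - \<beta>"
      using beta s by (intro order_trans[OF _ one_minus_beta_le]) auto
    show "((\<lambda>u. - ln (1 - u) - \<beta> * u) has_real_derivative (1 / (1 - u) - \<beta>)) (at u)"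
      using u s by (auto intro!: derivative_eq_intros)
  qed (use s in auto)
  finally show ?thesis
    by simp
qed

lemma P_integral_nonneg: "0 \<le> - ln (1 - s) - \<beta> * s" if "0 \<le> s" "s < 1"
proof -
  have "ln (1 - s) \<le> - s"
    using ln_add_one_self_le_self2[of "- s"] that by simp
  moreover have "\<beta> * s \<le> 1 * s"
    using beta that by (intro mult_right_mono) auto
  ultimately show ?thesis
    by simp
qed

lemma has_bochner_P:
  assumes s: "0 \<le> s" "s < 1"
  shows "has_bochner_integral M (\<lambda>x. P (s * x) / x) (- ln (1 - s) - \<beta> * s)"
proof (rule has_bochner_integral_nn_integral)
  show "AE x in M. 0 \<le> P (s * x) / x"
    using AE_M_pos by eventually_elim (use s P_nonneg in simp)
qed (use nn_integral_P[OF s] P_integral_nonneg[OF s] in auto)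

text \<open>By AM-GM the smallness of $\int dx / f$ on $[2y, 4y]$, which follows from the
  integrability of $P(x/2) / (x f(x))$, forces $\int f$ to be large there.\<close>

lemma P_growth:
  obtains C where "C > 0" "\<And>y. 0 < y \<Longrightarrow> y * P y \<le> C * P (4 * y)"
proof -
  define C where "C = (LINT x|M. P (x / 2) / x)"
  have int_C: "integrable M (\<lambda>x. P (x / 2) / x)"
    using has_bochner_P[of "1 / 2"] by (simp add: has_bochner_integral_iff)
  have main: "y * P y \<le> C * P (4 * y)" if y: "0 < y" for y
  proof -
    define I where "I = {2 * y..4 * y}"
    have [measurable]: "I \<in> sets borel"
      by (simp add: I_def)
    have Py: "0 < P y"
      using P_pos y by simp
    \<comment> \<open>Markov's inequality: on \<open>I\<close> the integrand
      \<open>P (x / 2) / x\<close> is at least \<open>P y / (4 * y)\<close>.\<close>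
    have B: "measure M I \<le> 4 * y * C / P y"
    proof -
      have "measure M I = (LINT x|M. indicator I x)"
        by simp
      also have "\<dots> \<le> (LINT x|M. (4 * y / P y) * (P (x / 2) / x))"
      proof (intro integral_mono_AE)
        show "integrable M (indicator I :: real \<Rightarrow> real)"
          by (simp add: emeasure_finite less_top[symmetric])
        show "AE x in M. indicator I x \<le> (4 * y / P y) * (P (x / 2) / x)"
          using AE_M_pos
        proof eventually_elim
          fix x :: real assume x: "0 < x"
          show "indicator I x \<le> (4 * y / P y) * (P (x / 2) / x)"
          proof (cases "x \<in> I")
            case True
            then have "P y \<le> P (x / 2)" "x \<le> 4 * y"
              using y by (auto simp: I_def intro: P_mono)
            then have "x * P y \<le> 4 * y * P (x / 2)"
              using x Py by (intro mult_mono) auto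
            then show ?thesis
              using True x Py by (simp add: field_simps)
          next
            case False
            then show ?thesis
              using x y Py P_nonneg[of "x / 2"] by simp
          qed
        qed
      qed (intro integrable_mult_right int_C)
      also have "\<dots> = 4 * y * C / P y"
        unfolding C_def by (subst Bochner_Integration.integral_mult_right[OF int_C]) simp
      finally show ?thesis .
    qed
    have C0: "0 \<le> C"
      unfolding C_def using AE_M_pos
      by (intro integral_nonneg_AE) (auto elim!: eventually_mono simp: P_nonneg)
    \<comment> \<open>Integrates \<open>2 \<le> \<theta> * f x + 1 / (\<theta> * f x)\<close> over
      \<open>I\<close>, with the weight \<theta> left free to be optimized.\<close>
    have two: "2 * (2 * y) \<le> \<theta> * P (4 * y) + measure M I / \<theta>" if th: "\<theta> > 0" for \<theta>
    proof -
      have i1: "integrable lborel (\<lambda>x. f x * indicator I x)"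
        and e1: "(LINT x|lborel. f x * indicator I x) = P (4 * y) - P (2 * y)"
        using has_bochner_integral_FTC_Icc_real[of "2 * y" "4 * y" P f] integral_FTC_Icc_real[of "2 * y" "4 * y" P f]
          y DERIV_P cont_f[of UNIV]
        by (auto simp: I_def has_bochner_integral_iff continuous_on_eq_continuous_at)
      have i2: "integrable lborel (\<lambda>x. indicator {0<..} x / f x * indicator I x)"
        and e2: "(LINT x|lborel. indicator {0<..} x / f x * indicator I x) = measure M I"
        using integrable_M[of "indicator I"] integral_M[of "indicator I"]
        by (auto simp: emeasure_finite less_top[symmetric])
      have "2 * (2 * y) = (LINT x|lborel. 2 * indicator I x)"
        using y by (simp add: I_def)
      also have "\<dots> \<le> (LINT x|lborel. \<theta> * (f x * indicator I x) + 1 / \<theta> * (indicator {0<..} x / f x * indicator I x))"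
      proof (intro integral_mono)
        show "integrable lborel (\<lambda>x. 2 * indicator I x :: real)"
          unfolding I_def by (intro integrable_mult_right integrable_real_indicator)
            (auto simp: emeasure_lborel_Icc_eq)
        fix x :: real
        show "2 * indicator I x \<le> \<theta> * (f x * indicator I x) + 1 / \<theta> * (indicator {0<..} x / f x * indicator I x)"
        proof (cases "x \<in> I")
          case True
          then have x: "0 < x" "0 < f x"
            using y f_pos[of x] by (auto simp: I_def)
          have "2 * (\<theta> * f x) \<le> (\<theta> * f x)\<^sup>2 + 1"
            using sum_squares_bound[of "\<theta> * f x" 1] by simp
          then show ?thesis
            using True x th by (simp add: field_simps power2_eq_square)
        qed simp
      qed (intro Bochner_Integration.integrable_add integrable_mult_right i1 i2)+
      also have "\<dots> = \<theta> * (P (4 * y) - P (2 * y)) + measure M I / \<theta>"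
        by (simp only: Bochner_Integration.integral_add[OF integrable_mult_right[OF i1] integrable_mult_right[OF i2]]
            integral_mult_right_zero e1 e2) simp
      also have "\<dots> \<le> \<theta> * P (4 * y) + measure M I / \<theta>"
        using P_nonneg[of "2 * y"] y th by (simp add: algebra_simps)
      finally show ?thesis .
    qed
    \<comment> \<open>If the measure were 0, the estimate at \<open>\<theta> = y / P (4 * y)\<close>
      would read \<open>4 * y \<le> y\<close>. Positivity gives \<open>C > 0\<close>, which makes
      the next \<theta> admissible.\<close>
    have "0 < measure M I"
      using two[of 1] two[of "y / (P (4 * y))"] P_pos[of "4 * y"] y
      by (smt (verit) C0 divide_eq_0_iff divide_pos_pos measure_nonneg nonzero_eq_divide_eq)
    with B have Cpos: "0 < C"
      using y Py C0 by (cases "C = 0") auto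
    \<comment> \<open>This \<theta> makes the second term at most \<open>2 * y\<close>, half of the
      left side.\<close>
    have "2 * (2 * y) \<le> 2 * C / P y * P (4 * y) + measure M I / (2 * C / P y)"
      using Cpos Py by (intro two) simp
    also have "measure M I / (2 * C / P y) \<le> (4 * y * C / P y) / (2 * C / P y)"
      using B Cpos Py by (intro divide_right_mono) auto
    also have "\<dots> = 2 * y"
      using Cpos Py by simp
    finally show ?thesis
      using Py by (simp add: field_simps)
  qed
  have "0 < P 1 \<and> 0 < P 4"
    by (simp add: P_pos)
  with main[of 1] have "C > 0"
    by (smt (verit) mult_nonpos_nonneg)
  with main show ?thesis
    using that by blast
qed

text \<open>Each use of \<open>P_growth\<close> buys one more factor \<open>x\<close> at the price
  of shrinking \<open>s\<close> to \<open>s / 4\<close>, starting from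
  \<open>s = 1 / 2\<close>.\<close>

lemma integrable_power_P:
  obtains s where "0 < s" "s < 1" "integrable M (\<lambda>x. x ^ k * (P (s * x) / x))"
proof -
  obtain C where C: "C > 0" "\<And>y. 0 < y \<Longrightarrow> y * P y \<le> C * P (4 * y)"
    using P_growth by blast
  have "\<exists>s. 0 < s \<and> s < 1 \<and> integrable M (\<lambda>x. x ^ k * (P (s * x) / x))"
  proof (induction k)
    case 0
    then show ?case
      using has_bochner_P[of "1 / 2"] by (intro exI[of _ "1 / 2"]) (simp add: has_bochner_integral_iff)
  next
    case (Suc k)
    then obtain s where s: "0 < s" "s < 1" "integrable M (\<lambda>x. x ^ k * (P (s * x) / x))"
      by blast
    have "integrable M (\<lambda>x. x ^ Suc k * (P (s / 4 * x) / x))"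
    proof (rule Bochner_Integration.integrable_bound)
      show "integrable M (\<lambda>x. (4 * C / s) * (x ^ k * (P (s * x) / x)))"
        using s by (intro integrable_mult_right) auto
      show "AE x in M. norm (x ^ Suc k * (P (s / 4 * x) / x))
          \<le> norm ((4 * C / s) * (x ^ k * (P (s * x) / x)))"
        using AE_M_pos
      proof eventually_elim
        fix x :: real assume x: "0 < x"
        have "x * P (s / 4 * x) \<le> (4 * C / s) * P (s * x)"
          using C(2)[of "s / 4 * x"] x s by (simp add: field_simps)
        then have "(x ^ k / x) * (x * P (s / 4 * x)) \<le> (x ^ k / x) * ((4 * C / s) * P (s * x))"
          using x by (intro mult_left_mono) auto
        moreover have "0 \<le> P (s / 4 * x)" "0 \<le> P (s * x)"
          using x s by (auto intro: P_nonneg)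
        ultimately show "norm (x ^ Suc k * (P (s / 4 * x) / x))
          \<le> norm ((4 * C / s) * (x ^ k * (P (s * x) / x)))"
          using x s C by (simp add: abs_mult field_simps)
      qed
    qed simp
    then show ?case
      using s by (intro exI[of _ "s / 4"]) auto
  qed
  then show ?thesis
    using that by blast
qed

text \<open>For \<open>x \<ge> 1\<close> the factor \<open>P (s * x) / P s\<close> is at least 1, so
  inserting it only enlarges the power; for \<open>x \<le> 1\<close> the power is at most 1 and
  \<open>M\<close> is finite.\<close>

lemma integrable_power: "integrable M (\<lambda>x. x ^ k)"
proof -
  obtain s where s: "0 < s" "s < 1" "integrable M (\<lambda>x. x ^ Suc k * (P (s * x) / x))"
    using integrable_power_P by blast
  show ?thesis
  proof (rule Bochner_Integration.integrable_bound)
    show "integrable M (\<lambda>x. 1 + x ^ Suc k * (P (s * x) / x) / P s)"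
      by (intro Bochner_Integration.integrable_add integrable_M_1 integrable_divide s)
    show "AE x in M. norm (x ^ k) \<le> norm (1 + x ^ Suc k * (P (s * x) / x) / P s)"
      using AE_M_pos
    proof eventually_elim
      fix x :: real assume x: "0 < x"
      have nn: "0 \<le> P (s * x)" "0 < P s"
        using s x by (auto intro: P_nonneg P_pos)
      have "x ^ k \<le> 1 + x ^ k * (P (s * x) / P s)"
      proof (cases "x \<le> 1")
        case True
        then have "x ^ k \<le> 1"
          using x by (intro power_le_one) auto
        moreover have "0 \<le> x ^ k * (P (s * x) / P s)"
          using nn x by simp
        ultimately show ?thesis
          by linarith
      next
        case False
        then have "P s \<le> P (s * x)"
          using s by (intro P_mono) auto
        then have "x ^ k * 1 \<le> x ^ k * (P (s * x) / P s)"
          using nn x by (intro mult_left_mono) auto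
        then show ?thesis
          by simp
      qed
      then show "norm (x ^ k) \<le> norm (1 + x ^ Suc k * (P (s * x) / x) / P s)"
        using x nn by (simp add: field_simps)
    qed
  qed simp
qed

section \<open>Taylor remainders and the moment identities\<close>

definition R where "R k x = (\<Sum>i. c (i + k) / real (Suc (i + k)) * x ^ i)"

lemma summable_R: "summable (\<lambda>i. c (i + k) / real (Suc (i + k)) * x ^ i)"
  using summable_q[of x] summable_powser_ignore_initial_segment[of "\<lambda>i. c i / real (Suc i)" k x]
  by simp

lemma cont_R: "continuous_on A (R k)"
  unfolding R_def using isCont_powser_converges_everywhere[OF summable_R]
  by (simp add: continuous_at_imp_continuous_on)

lemma R_measurable [measurable]: "R k \<in> borel_measurable borel"
  using cont_R by (auto intro: borel_measurable_continuous_onI)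

lemma R_0: "R k 0 = c k / real (Suc k)"
  unfolding R_def by (subst powser_zero) simp

lemma Q_split: "Q x = (\<Sum>i<k. c i / real (Suc i) * x ^ i) + x ^ k * R k x"
proof -
  have "Q x = (\<Sum>i. c (i + k) / real (Suc (i + k)) * x ^ (i + k)) + (\<Sum>i<k. c i / real (Suc i) * x ^ i)"
    unfolding Q_def by (rule suminf_split_initial_segment[OF summable_q])
  also have "(\<Sum>i. c (i + k) / real (Suc (i + k)) * x ^ (i + k)) = x ^ k * R k x"
    unfolding R_def by (subst suminf_mult[OF summable_R, symmetric]) (simp add: power_add algebra_simps)
  finally show ?thesis
    by simp
qed

text \<open>On [0, 1] this is compactness. For \<open>x > 1\<close>, \<open>x ^ k * R k x\<close> is
  \<open>Q x\<close> minus a polynomial of degree below \<open>k\<close>; here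
  \<open>Q \<le> P\<close>, and the polynomial is at most a constant times
  \<open>x ^ k\<close>.\<close>

lemma R_bound:
  obtains C where "C \<ge> 0" "\<And>x. 0 \<le> x \<Longrightarrow> \<bar>R k x\<bar> \<le> C * (1 + P x)"
proof -
  have "bounded (R k ` {0..1})"
    by (intro compact_imp_bounded compact_continuous_image cont_R compact_Icc)
  then obtain B where B: "B > 0" "\<And>x. x \<in> {0..1} \<Longrightarrow> \<bar>R k x\<bar> \<le> B"
    unfolding bounded_pos by force
  define S where "S = (\<Sum>i<k. \<bar>c i / real (Suc i)\<bar>)"
  have S: "S \<ge> 0"
    by (simp add: S_def sum_nonneg)
  have "\<bar>R k x\<bar> \<le> (B + S + 1) * (1 + P x)" if x: "0 \<le> x" for x
  proof (cases "x \<le> 1")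
    case True
    then have "\<bar>R k x\<bar> \<le> B * 1"
      using B x by simp
    also have "\<dots> \<le> (B + S + 1) * (1 + P x)"
      using B S P_nonneg[OF x] by (intro mult_mono) auto
    finally show ?thesis .
  next
    case False
    have xk: "1 \<le> x ^ i" for i
      using False by (intro one_le_power) simp
    have "\<bar>\<Sum>i<k. c i / real (Suc i) * x ^ i\<bar> \<le> (\<Sum>i<k. \<bar>c i / real (Suc i)\<bar> * x ^ k)"
      using False
      by (intro order_trans[OF sum_abs] sum_mono)
         (auto simp: abs_mult intro!: mult_left_mono power_increasing divide_right_mono)
    also have "\<dots> = S * x ^ k"
      by (simp add: S_def sum_distrib_right)
    finally have sum: "\<bar>\<Sum>i<k. c i / real (Suc i) * x ^ i\<bar> \<le> S * x ^ k" .
    have "0 \<le> Q x" "Q x \<le> P x"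
      using P_nonneg[OF x] False mult_right_mono[of 1 x "Q x"]
      by (auto simp: P_def zero_le_mult_iff)
    then have "\<bar>Q x\<bar> \<le> P x * x ^ k"
      using xk[of k] mult_left_mono[of 1 "x ^ k" "P x"] P_nonneg[OF x] by simp
    moreover have "\<bar>R k x\<bar> * x ^ k = \<bar>Q x - (\<Sum>i<k. c i / real (Suc i) * x ^ i)\<bar>"
      using False by (simp add: Q_split[of x k] abs_mult)
    ultimately have "\<bar>R k x\<bar> * x ^ k \<le> (P x + S) * x ^ k"
      using sum by (simp add: algebra_simps)
    then have "\<bar>R k x\<bar> \<le> P x + S"
      using xk[of k] by (simp add: mult_le_cancel_right)
    also have "\<dots> \<le> (B + S + 1) * (1 + P x)"
      using B S P_nonneg[OF x] by (simp add: algebra_simps)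
    finally show ?thesis .
  qed
  then show ?thesis
    using that[of "B + S + 1"] B S by simp
qed

text \<open>The Taylor coefficients at 0 of \<open>1 / (1 - s) - \<beta>\<close>.\<close>

definition \<tau> :: "nat \<Rightarrow> real" where "\<tau> k = (if k = 0 then 1 - \<beta> else 1)"

lemma \<tau>_sums:
  assumes "0 \<le> s" "s < 1"
  shows "(\<lambda>i. \<tau> i / real (Suc i) * s ^ Suc i) sums (- ln (1 - s) - \<beta> * s)"
proof -
  have "(\<lambda>n. - (- ((- (- s)) ^ n) / real n)) sums (- ln (1 + - s))"
    using ln_series'[of "- s"] assms by (intro sums_minus) auto
  then have "(\<lambda>n. s ^ n / real n) sums (- ln (1 - s))"
    by simp
  then have "(\<lambda>n. s ^ Suc n / real (Suc n)) sums (- ln (1 - s))"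
    by (subst sums_Suc_iff) simp
  moreover have "(\<lambda>n. if n = 0 then \<beta> * s else 0) sums (\<beta> * s)"
    using sums_single[of 0 "\<lambda>_. \<beta> * s"] by simp
  ultimately have "(\<lambda>n. s ^ Suc n / real (Suc n) - (if n = 0 then \<beta> * s else 0)) sums (- ln (1 - s) - \<beta> * s)"
    by (rule sums_diff)
  moreover have "s ^ Suc n / real (Suc n) - (if n = 0 then \<beta> * s else 0) = \<tau> n / real (Suc n) * s ^ Suc n" for n
    by (simp add: \<tau>_def algebra_simps)
  ultimately show ?thesis
    by simp
qed

text \<open>Both sides of the integrated functional equation are expanded at $s = 0$; the remainder
  \<^term>\<open>R\<close> of the left-hand side is dominated.\<close>

lemma moment: "c k * (LINT x|M. x ^ k) = \<tau> k"
proof (induction k rule: less_induct)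
  case (less k)
  obtain s1 where s1: "0 < s1" "s1 < 1" "integrable M (\<lambda>x. x ^ Suc k * (P (s1 * x) / x))"
    using integrable_power_P by blast
  obtain C where C: "C \<ge> 0" "\<And>x. 0 \<le> x \<Longrightarrow> \<bar>R k x\<bar> \<le> C * (1 + P x)"
    using R_bound by blast
  \<comment> \<open>A majorant independent of \<open>s\<close>: monotonicity of \<open>P\<close>
    allows \<open>s\<close> to be replaced by \<open>s1\<close> in the bound on the
    remainder.\<close>
  define D where "D x = C * (x ^ k + x ^ Suc k * (P (s1 * x) / x))" for x
  have D: "integrable M D"
    unfolding D_def by (intro integrable_mult_right Bochner_Integration.integrable_add integrable_power s1)
  have D_bound: "AE x in M. norm (x ^ k * R k (s * x)) \<le> D x" if s: "0 < s" "s \<le> s1" for s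
    using AE_M_pos
  proof eventually_elim
    fix x :: real assume x: "0 < x"
    have "P (s * x) \<le> P (s1 * x)"
      using s x by (intro P_mono) auto
    then have "C * (1 + P (s * x)) \<le> C * (1 + P (s1 * x))"
      using C(1) by (intro mult_left_mono) auto
    then have "\<bar>R k (s * x)\<bar> \<le> C * (1 + P (s1 * x))"
      using C(2)[of "s * x"] s x by simp
    then have "x ^ k * \<bar>R k (s * x)\<bar> \<le> x ^ k * (C * (1 + P (s1 * x)))"
      using x by (intro mult_left_mono) auto
    then show "norm (x ^ k * R k (s * x)) \<le> D x"
      using x by (simp add: D_def abs_mult algebra_simps)
  qed
  define T where "T s = (\<Sum>i. \<tau> (i + k) / real (Suc (i + k)) * s ^ i)" for s
  have sm: "summable (\<lambda>i. \<tau> (i + k) / real (Suc (i + k)) * s ^ i)" if "0 < s" "s < 1" for s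
  proof -
    have "(\<lambda>i. inverse s * (\<tau> i / real (Suc i) * s ^ Suc i)) sums (inverse s * (- ln (1 - s) - \<beta> * s))"
      using that by (intro sums_mult \<tau>_sums) auto
    then have "summable (\<lambda>i. \<tau> i / real (Suc i) * s ^ i)"
      using that by (simp add: sums_iff field_simps)
    then show ?thesis
      using summable_powser_ignore_initial_segment[of "\<lambda>i. \<tau> i / real (Suc i)" k s] by simp
  qed
  \<comment> \<open>By the induction hypothesis the terms below \<open>k\<close> agree on both
    sides; cancelling them and dividing by \<open>s ^ Suc k\<close> leaves an identity between
    remainders.\<close>
  have int_R: "(LINT x|M. x ^ k * R k (s * x)) = T s" if s: "0 < s" "s \<le> s1" for s
  proof -
    have s_lt: "s < 1"
      using s s1 by simp
    have iR: "integrable M (\<lambda>x. x ^ k * R k (s * x))"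
    proof (rule Bochner_Integration.integrable_bound[OF D])
      show "AE x in M. norm (x ^ k * R k (s * x)) \<le> norm (D x)"
        using D_bound[OF s] by eventually_elim simp
    qed simp
    have "- ln (1 - s) - \<beta> * s = (LINT x|M. P (s * x) / x)"
      using has_bochner_P[of s] s s_lt by (simp add: has_bochner_integral_iff)
    also have "\<dots> = (LINT x|M. (\<Sum>i<k. (c i / real (Suc i) * s ^ Suc i) * x ^ i) + s ^ Suc k * (x ^ k * R k (s * x)))"
    proof (intro integral_cong_AE)
      show "AE x in M. P (s * x) / x
          = (\<Sum>i<k. (c i / real (Suc i) * s ^ Suc i) * x ^ i) + s ^ Suc k * (x ^ k * R k (s * x))"
        using AE_M_pos
      proof eventually_elim
        fix x :: real assume x: "0 < x"
        then have "P (s * x) / x = s * Q (s * x)"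
          by (simp add: P_def)
        then show "P (s * x) / x
          = (\<Sum>i<k. (c i / real (Suc i) * s ^ Suc i) * x ^ i) + s ^ Suc k * (x ^ k * R k (s * x))"
          by (simp add: Q_split[of "s * x" k] distrib_left sum_distrib_left power_mult_distrib mult_ac)
      qed
    qed simp_all
    also have "\<dots> = (\<Sum>i<k. (c i / real (Suc i) * s ^ Suc i) * (LINT x|M. x ^ i))
        + s ^ Suc k * (LINT x|M. x ^ k * R k (s * x))"
      using iR integrable_power
      by (subst Bochner_Integration.integral_add) (auto simp: Bochner_Integration.integral_sum)
    also have "(\<Sum>i<k. (c i / real (Suc i) * s ^ Suc i) * (LINT x|M. x ^ i))
        = (\<Sum>i<k. \<tau> i / real (Suc i) * s ^ Suc i)"
      by (intro sum.cong) (auto simp: less.IH[symmetric])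
    finally have 1: "s ^ Suc k * (LINT x|M. x ^ k * R k (s * x))
        = - ln (1 - s) - \<beta> * s - (\<Sum>i<k. \<tau> i / real (Suc i) * s ^ Suc i)"
      by simp
    have "(\<lambda>i. \<tau> (i + k) / real (Suc (i + k)) * s ^ Suc (i + k)) sums
        (- ln (1 - s) - \<beta> * s - (\<Sum>i<k. \<tau> i / real (Suc i) * s ^ Suc i))"
      using s s_lt by (intro sums_split_initial_segment \<tau>_sums) auto
    moreover have "(\<lambda>i. s ^ Suc k * (\<tau> (i + k) / real (Suc (i + k)) * s ^ i)) sums (s ^ Suc k * T s)"
      unfolding T_def using s s_lt by (intro sums_mult summable_sums sm) auto
    ultimately have "s ^ Suc k * T s = - ln (1 - s) - \<beta> * s - (\<Sum>i<k. \<tau> i / real (Suc i) * s ^ Suc i)"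
      by (intro sums_unique2[of _ "s ^ Suc k * T s"]) (simp_all add: power_add mult_ac)
    with 1 have "s ^ Suc k * (LINT x|M. x ^ k * R k (s * x)) = s ^ Suc k * T s"
      by (simp only:)
    then show ?thesis
      using s by simp
  qed
  \<comment> \<open>Letting \<open>s\<close> tend to 0 along this sequence isolates the coefficients
    of index \<open>k\<close>, because \<open>R k 0\<close> and \<open>T 0\<close> are the leading
    terms of the remainders.\<close>
  define \<sigma> where "\<sigma> n = s1 * inverse (real (Suc n))" for n
  have \<sigma>: "0 < \<sigma> n" "\<sigma> n \<le> s1" for n
    using s1 by (auto simp: \<sigma>_def field_simps)
  have \<sigma>_lim: "\<sigma> \<longlonglongrightarrow> 0"
    unfolding \<sigma>_def using LIMSEQ_inverse_real_of_nat by (rule tendsto_mult_right_zero)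
  have "(\<lambda>n. LINT x|M. x ^ k * R k (\<sigma> n * x)) \<longlonglongrightarrow> (LINT x|M. x ^ k * R k 0)"
  proof (rule integral_dominated_convergence[where w = D])
    show "AE x in M. (\<lambda>n. x ^ k * R k (\<sigma> n * x)) \<longlonglongrightarrow> x ^ k * R k 0"
    proof (intro AE_I2 tendsto_mult_left)
      fix x
      have "isCont (R k) 0"
        using cont_R[of UNIV] by (simp add: continuous_on_eq_continuous_at)
      moreover have "(\<lambda>n. \<sigma> n * x) \<longlonglongrightarrow> 0"
        using \<sigma>_lim by (rule tendsto_mult_left_zero)
      ultimately show "(\<lambda>n. R k (\<sigma> n * x)) \<longlonglongrightarrow> R k 0"
        by (rule isCont_tendsto_compose)
    qed
  qed (use D D_bound[OF \<sigma>] in auto)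
  then have "(\<lambda>n. T (\<sigma> n)) \<longlonglongrightarrow> R k 0 * (LINT x|M. x ^ k)"
    by (simp add: int_R[OF \<sigma>] mult.commute[of "R k 0"])
  moreover have "isCont T 0"
    unfolding T_def by (rule isCont_powser[of _ "1 / 2"]) (use sm in auto)
  then have "(\<lambda>n. T (\<sigma> n)) \<longlonglongrightarrow> T 0"
    using \<sigma>_lim by (rule isCont_tendsto_compose)
  ultimately have "R k 0 * (LINT x|M. x ^ k) = T 0"
    by (rule LIMSEQ_unique)
  moreover have "T 0 = \<tau> k / real (Suc k)"
    unfolding T_def by (subst powser_zero) simp
  ultimately show ?case
    by (simp add: R_0 field_simps)
qed

text \<open>The moments are nonnegative, and for \<open>k > 0\<close> the product of
  \<open>c k\<close> with its moment is 1.\<close>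

lemma c_pos: "0 < c k"
proof (cases "k = 0")
  case False
  have "0 \<le> (LINT x|M. x ^ k)"
    using AE_M_pos by (intro integral_nonneg_AE) (auto elim!: eventually_mono)
  moreover have "c k * (LINT x|M. x ^ k) = 1"
    using moment[of k] False by (simp add: \<tau>_def)
  ultimately show ?thesis
    by (smt (verit) mult_nonpos_nonneg)
qed (simp add: c_0)

end

subsection \<open>Karamata's Tauberian theorem\<close>

text \<open>For a monomial \<open>G\<close> the claim is the hypothesis at a rescaled
  \<open>t\<close>. Polynomials follow by linearity and continuous \<open>G\<close> by Weierstrass,
  the extra factor \<open>exp (- u x / t)\<close> keeping the approximation error
  integrable.\<close>

lemma karamata_continuous:
  fixes N :: "'a measure" and u :: "'a \<Rightarrow> real" and G :: "real \<Rightarrow> real"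
  assumes [measurable]: "u \<in> borel_measurable N"
    and nonneg: "\<And>x. x \<in> space N \<Longrightarrow> 0 \<le> u x"
    and int: "\<And>t. 0 < t \<Longrightarrow> integrable N (\<lambda>x. exp (- u x / t))"
    and lim: "((\<lambda>t. (LINT x|N. exp (- u x / t)) / t) \<longlongrightarrow> 1) at_top"
    and G: "continuous_on UNIV G"
  shows "\<And>t. 0 < t \<Longrightarrow> integrable N (\<lambda>x. exp (- u x / t) * G (exp (- u x / t)))"
    and "((\<lambda>t. (LINT x|N. exp (- u x / t) * G (exp (- u x / t))) / t) \<longlongrightarrow> integral {0..1} G) at_top"
proof -
  define J where "J G t = (LINT x|N. exp (- u x / t) * G (exp (- u x / t))) / t" for G :: "real \<Rightarrow> real" and t
  have w: "exp (- u x / t) \<in> {0..1}" if "x \<in> space N" "0 < t" for x t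
    using nonneg[OF that(1)] that(2) by simp
  have int_cont: "integrable N (\<lambda>x. exp (- u x / t) * G (exp (- u x / t)))"
    if G: "continuous_on UNIV G" and t: "0 < t" for t and G :: "real \<Rightarrow> real"
  proof -
    have [measurable]: "G \<in> borel_measurable borel"
      using G by (rule borel_measurable_continuous_onI)
    have "bounded (G ` {0..1})"
      using G by (intro compact_imp_bounded compact_continuous_image) (auto intro: continuous_on_subset)
    then obtain B where B: "\<And>y. y \<in> {0..1} \<Longrightarrow> \<bar>G y\<bar> \<le> B"
      unfolding bounded_iff by force
    show ?thesis
    proof (rule Bochner_Integration.integrable_bound)
      show "integrable N (\<lambda>x. B * exp (- u x / t))"
        using int[OF t] by (rule integrable_mult_right)
      show "AE x in N. norm (exp (- u x / t) * G (exp (- u x / t))) \<le> norm (B * exp (- u x / t))"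
      proof (intro AE_I2)
        fix x assume "x \<in> space N"
        then have "\<bar>G (exp (- u x / t))\<bar> \<le> \<bar>B\<bar>"
          using B[OF w[of x t]] t by linarith
        then show "norm (exp (- u x / t) * G (exp (- u x / t))) \<le> norm (B * exp (- u x / t))"
          by (simp add: abs_mult mult.commute mult_right_mono)
      qed
    qed simp
  qed
  show "integrable N (\<lambda>x. exp (- u x / t) * G (exp (- u x / t)))" if "0 < t" for t
    using int_cont[OF G that] .
  \<comment> \<open>The power \<open>exp (- u x / t) ^ Suc j\<close> is the same exponential at
    \<open>t / Suc j\<close>, whence the factor \<open>1 / Suc j\<close>, the integral of
    \<open>y ^ j\<close> over [0, 1].\<close>
  have mono: "J (\<lambda>y. a * y ^ j) t = a / real (Suc j) * ((LINT x|N. exp (- u x / (t / real (Suc j)))) / (t / real (Suc j)))"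
    for a j t
  proof -
    have "exp (- u x / t) * (a * exp (- u x / t) ^ j) = a * exp (- u x / (t / real (Suc j)))" for x
    proof -
      have "exp (- u x / t) * (a * exp (- u x / t) ^ j) = a * exp (- u x / t) ^ Suc j"
        by simp
      also have "exp (- u x / t) ^ Suc j = exp (- u x / (t / real (Suc j)))"
        unfolding exp_of_nat_mult[symmetric] by (simp add: mult.commute)
      finally show ?thesis .
    qed
    then show ?thesis
      unfolding J_def by (simp only: integral_mult_right_zero) (simp del: of_nat_Suc)
  qed
  have J_mono: "(J (\<lambda>y. a * y ^ j) \<longlongrightarrow> a / real (Suc j)) at_top" for a j
  proof -
    have "filterlim (\<lambda>t. t / real (Suc j)) at_top at_top"
      using filterlim_tendsto_pos_mult_at_top[OF tendsto_const[of "inverse (real (Suc j))"] _ filterlim_ident]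
      by (simp add: field_simps)
    from tendsto_mult_left[OF filterlim_compose[OF lim this], of "a / real (Suc j)"]
    show ?thesis
      unfolding mono by simp
  qed
  have J_poly: "(J (\<lambda>y. \<Sum>j\<le>n. a j * y ^ j) \<longlongrightarrow> integral {0..1} (\<lambda>y. \<Sum>j\<le>n. a j * y ^ j)) at_top" for a n
  proof -
    have "((\<lambda>y::real. y ^ j) has_integral 1 / real (Suc j)) {0..1}" for j
    proof -
      have "((\<lambda>y. y ^ Suc j / real (Suc j)) has_real_derivative y ^ j) (at y within {0..1})" for y
        using DERIV_cdivide[OF DERIV_pow[of "Suc j" y "{0..1}"], of "real (Suc j)"] by simp
      then have "((\<lambda>y::real. y ^ j) has_integral 1 ^ Suc j / real (Suc j) - 0 ^ Suc j / real (Suc j)) {0..1}"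
        by (intro fundamental_theorem_of_calculus)
           (auto simp: has_real_derivative_iff_has_vector_derivative)
      then show ?thesis
        by simp
    qed
    then have "((\<lambda>y. \<Sum>j\<le>n. a j * y ^ j) has_integral (\<Sum>j\<le>n. a j * (1 / real (Suc j)))) {0..1}"
      by (intro has_integral_sum has_integral_mult_right) auto
    then have *: "integral {0..1} (\<lambda>y. \<Sum>j\<le>n. a j * y ^ j) = (\<Sum>j\<le>n. a j / real (Suc j))"
      by (simp add: integral_unique)
    have "((\<lambda>t. \<Sum>j\<le>n. J (\<lambda>y. a j * y ^ j) t) \<longlongrightarrow> (\<Sum>j\<le>n. a j / real (Suc j))) at_top"
      by (intro tendsto_sum J_mono)
    moreover have "eventually (\<lambda>t. (\<Sum>j\<le>n. J (\<lambda>y. a j * y ^ j) t) = J (\<lambda>y. \<Sum>j\<le>n. a j * y ^ j) t) at_top"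
      using eventually_gt_at_top[of 0]
    proof eventually_elim
      case (elim t)
      have "(LINT x|N. (\<Sum>j\<le>n. exp (- u x / t) * (a j * exp (- u x / t) ^ j)))
          = (\<Sum>j\<le>n. LINT x|N. exp (- u x / t) * (a j * exp (- u x / t) ^ j))"
        using elim by (intro Bochner_Integration.integral_sum int_cont continuous_intros) auto
      then show ?case
        by (simp add: J_def sum_distrib_left sum_divide_distrib)
    qed
    ultimately show ?thesis
      unfolding * by (rule Lim_transform_eventually)
  qed
  have "(J G \<longlongrightarrow> integral {0..1} G) at_top"
  proof (rule tendstoI)
    fix e :: real assume e: "0 < e"
    \<comment> \<open>With accuracy \<open>e / 4\<close> the integrals of \<open>G\<close> and
      \<open>g\<close> differ by at most \<open>e / 4\<close>, \<open>J G\<close> and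
      \<open>J g\<close> by less than \<open>e / 2\<close> once the normalized transform is below 2,
      and \<open>J g\<close> is within \<open>e / 4\<close> of its limit.\<close>
    obtain g where "real_polynomial_function g" and g: "\<And>y. y \<in> {0..1} \<Longrightarrow> \<bar>G y - g y\<bar> < e / 4"
      using Stone_Weierstrass_real_polynomial_function[of "{0..1}" G "e / 4"] G e
      by (metis compact_Icc continuous_on_subset subset_UNIV zero_less_divide_iff zero_less_numeral)
    then obtain a n where g_eq: "g = (\<lambda>y. \<Sum>j\<le>n. a j * y ^ j)"
      by (auto simp: real_polynomial_function_iff_sum)
    have g_cont: "continuous_on UNIV g"
      unfolding g_eq by (intro continuous_intros)
    have int_G_g: "\<bar>integral {0..1} G - integral {0..1} g\<bar> \<le> e / 4"
    proof -
      have "(\<lambda>y. G y - g y) integrable_on {0..1}"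
        using G g_cont by (intro integrable_continuous_real continuous_intros) (auto intro: continuous_on_subset)
      moreover have "G integrable_on {0..1}" "g integrable_on {0..1}"
        using G g_cont by (auto intro!: integrable_continuous_real intro: continuous_on_subset)
      ultimately have "integral {0..1} G - integral {0..1} g = integral {0..1} (\<lambda>y. G y - g y)"
        by (simp add: Henstock_Kurzweil_Integration.integral_diff)
      moreover have "norm (integral {0..1} (\<lambda>y. G y - g y)) \<le> integral {0..1} (\<lambda>y::real. e / 4)"
        using g \<open>(\<lambda>y. G y - g y) integrable_on {0..1}\<close>
        by (intro integral_norm_bound_integral) (auto intro: less_imp_le)
      ultimately show ?thesis
        by simp
    qed
    have "eventually (\<lambda>t. \<bar>J g t - integral {0..1} g\<bar> < e / 4) at_top"
      using tendstoD[OF J_poly[where n = n and a = a], of "e / 4"] e unfolding g_eq by (simp add: dist_real_def)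
    moreover have "eventually (\<lambda>t. \<bar>J G t - J g t\<bar> \<le> e / 4 * ((LINT x|N. exp (- u x / t)) / t)) at_top"
      using eventually_gt_at_top[of 0]
    proof eventually_elim
      case (elim t)
      have "J G t - J g t = (LINT x|N. exp (- u x / t) * (G (exp (- u x / t)) - g (exp (- u x / t)))) / t"
        unfolding J_def diff_divide_distrib[symmetric]
        using int_cont[OF G elim] int_cont[OF g_cont elim]
        by (subst Bochner_Integration.integral_diff[symmetric]) (simp_all add: algebra_simps)
      also have "\<bar>\<dots>\<bar> \<le> (LINT x|N. e / 4 * exp (- u x / t)) / t"
      proof -
        have "\<bar>LINT x|N. exp (- u x / t) * (G (exp (- u x / t)) - g (exp (- u x / t)))\<bar>
            \<le> (LINT x|N. \<bar>exp (- u x / t) * (G (exp (- u x / t)) - g (exp (- u x / t)))\<bar>)"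
          by (rule integral_abs_bound)
        also have "\<dots> \<le> (LINT x|N. e / 4 * exp (- u x / t))"
        proof (intro integral_mono)
          show "integrable N (\<lambda>x. \<bar>exp (- u x / t) * (G (exp (- u x / t)) - g (exp (- u x / t)))\<bar>)"
            using G g_cont elim by (intro integrable_abs int_cont[of "\<lambda>y. G y - g y"] continuous_intros)
          fix x assume "x \<in> space N"
          then show "\<bar>exp (- u x / t) * (G (exp (- u x / t)) - g (exp (- u x / t)))\<bar> \<le> e / 4 * exp (- u x / t)"
            using g[OF w[of x t]] elim by (simp add: abs_mult mult.commute mult_left_mono less_imp_le)
        qed (intro integrable_mult_right int elim)
        finally show ?thesis
          unfolding abs_divide using elim by (simp only: abs_of_pos divide_right_mono less_imp_le)
      qed
      finally show ?case
        by simp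
    qed
    moreover have "eventually (\<lambda>t. (LINT x|N. exp (- u x / t)) / t < 2) at_top"
      using order_tendstoD(2)[OF lim, of 2] by simp
    ultimately show "eventually (\<lambda>t. dist (J G t) (integral {0..1} G) < e) at_top"
    proof eventually_elim
      case (elim t)
      have "e / 4 * ((LINT x|N. exp (- u x / t)) / t) < e / 4 * 2"
        using elim e by (intro mult_strict_left_mono) auto
      then show ?case
        using elim int_G_g unfolding dist_real_def by linarith
    qed
  qed
  then show "((\<lambda>t. (LINT x|N. exp (- u x / t) * G (exp (- u x / t))) / t) \<longlongrightarrow> integral {0..1} G) at_top"
    unfolding J_def .
qed

text \<open>Trapezoidal version of the function $1_{y \ge b} / y$.\<close>

definition ramp :: "real \<Rightarrow> real \<Rightarrow> real \<Rightarrow> real" where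
  "ramp a b y = max 0 (min 1 ((y - a) / (b - a))) / max y a"

lemma ramp_cont: "0 < a \<Longrightarrow> a < b \<Longrightarrow> continuous_on UNIV (ramp a b)"
  unfolding ramp_def by (intro continuous_intros) auto

text \<open>With \<open>y = exp (- u / t)\<close>, the condition \<open>y \<ge> exp (- l)\<close>
  says \<open>u \<le> l * t\<close>, so these bounds sandwich distribution functions of
  \<open>u\<close>.\<close>

lemma ramp_mult_le: "0 < a \<Longrightarrow> a < b \<Longrightarrow> 0 \<le> y \<Longrightarrow> y * ramp a b y \<le> indicator {a..} y"
  and ramp_mult_ge: "0 < a \<Longrightarrow> a < b \<Longrightarrow> 0 \<le> y \<Longrightarrow> indicator {b..} y \<le> y * ramp a b y"
  and ramp_nonneg: "0 < a \<Longrightarrow> a < b \<Longrightarrow> 0 \<le> ramp a b y"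
  by (auto simp: ramp_def indicator_def max_def min_def field_simps)

text \<open>Comparison with \<open>1 / y\<close>, which \<open>ramp\<close> equals on [b, 1] and
  does not exceed on [a, 1]; below \<open>a\<close> it vanishes.\<close>

lemma ramp_integral:
  assumes "0 < a" "a < b" "b \<le> 1"
  shows "- ln b \<le> integral {0..1} (ramp a b)" "integral {0..1} (ramp a b) \<le> - ln a"
proof -
  have inv: "((\<lambda>y. 1 / y) has_integral (- ln z)) {z..1}" if "0 < z" "z \<le> 1" for z :: real
  proof -
    have "((\<lambda>y. 1 / y) has_integral (ln 1 - ln z)) {z..1}"
      using that by (intro fundamental_theorem_of_calculus)
        (auto intro!: derivative_eq_intros simp: has_real_derivative_iff_has_vector_derivative[symmetric])
    then show ?thesis
      by simp
  qed
  have "ramp a b integrable_on {0..1}" "ramp a b integrable_on {b..1}" "ramp a b integrable_on {a..1}"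
    by (intro integrable_continuous_real continuous_on_subset[OF ramp_cont] assms subset_UNIV)+
  note int = this
  have "- ln b \<le> integral {b..1} (ramp a b)"
  proof (rule has_integral_le[OF inv integrable_integral[OF int(2)]])
    fix y assume "y \<in> {b..1}"
    then show "1 / y \<le> ramp a b y"
      using ramp_mult_ge[of a b y] assms by (simp add: field_simps)
  qed (use assms in auto)
  also have "\<dots> \<le> integral {0..1} (ramp a b)"
    using assms by (intro integral_subset_le int) (auto intro: ramp_nonneg)
  finally show "- ln b \<le> integral {0..1} (ramp a b)" .
  have "integral {0..1} (ramp a b) = integral {a..1} (ramp a b)"
  proof -
    have "integral {0..a} (ramp a b) = integral {0..a} (\<lambda>_. 0)"
      using assms by (intro integral_cong) (auto simp: ramp_def max_def zero_le_divide_iff)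
    then show ?thesis
      using Henstock_Kurzweil_Integration.integral_combine[OF _ _ int(1), of a] assms by simp
  qed
  also have "\<dots> \<le> - ln a"
  proof (rule has_integral_le[OF integrable_integral[OF int(3)] inv])
    fix y assume "y \<in> {a..1}"
    then show "ramp a b y \<le> 1 / y"
      using ramp_mult_le[of a b y] assms by (simp add: field_simps)
  qed (use assms in auto)
  finally show "integral {0..1} (ramp a b) \<le> - ln a" .
qed

text \<open>\<open>u x \<le> t\<close> means \<open>exp (- u x / t) \<ge> exp (- 1)\<close>. The
  discontinuous indicator is squeezed between ramps whose integrals are arbitrarily close to
  1.\<close>

lemma karamata_tauberian:
  fixes N :: "'a measure" and u :: "'a \<Rightarrow> real"
  assumes meas [measurable]: "u \<in> borel_measurable N"
    and nonneg: "\<And>x. x \<in> space N \<Longrightarrow> 0 \<le> u x"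
    and int: "\<And>t. 0 < t \<Longrightarrow> integrable N (\<lambda>x. exp (- u x / t))"
    and lim: "((\<lambda>t. (LINT x|N. exp (- u x / t)) / t) \<longlongrightarrow> 1) at_top"
  shows "\<And>t. emeasure N {x \<in> space N. u x \<le> t} < \<infinity>"
    and "((\<lambda>t. measure N {x \<in> space N. u x \<le> t} / t) \<longlongrightarrow> 1) at_top"
proof -
  have fin: "emeasure N {x \<in> space N. u x \<le> t} < \<infinity>" for t
  proof -
    have "integrable N (indicator {x \<in> space N. u x \<le> t} :: 'a \<Rightarrow> real)"
    proof (rule Bochner_Integration.integrable_bound)
      \<comment> \<open>\<open>max 1 t\<close> supplies a positive scale even when
        \<open>t \<le> 0\<close>.\<close>
      show "integrable N (\<lambda>x. exp 1 * exp (- u x / max 1 t))"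
        by (intro integrable_mult_right int) simp
      show "AE x in N. norm (indicator {x \<in> space N. u x \<le> t} x :: real) \<le> norm (exp 1 * exp (- u x / max 1 t))"
        by (intro AE_I2) (auto simp: indicator_def exp_add[symmetric] field_simps)
    qed simp
    then show ?thesis
      by (simp add: integrable_indicator_iff Int_absorb2)
  qed
  show "emeasure N {x \<in> space N. u x \<le> t} < \<infinity>" for t
    using fin .
  define F where "F t = measure N {x \<in> space N. u x \<le> t}" for t
  have F: "F t = (LINT x|N. indicator {x \<in> space N. u x \<le> t} x)"
    and F_int: "integrable N (indicator {x \<in> space N. u x \<le> t} :: 'a \<Rightarrow> real)" for t
    using fin by (auto simp: F_def)
  show "((\<lambda>t. measure N {x \<in> space N. u x \<le> t} / t) \<longlongrightarrow> 1) at_top"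
    unfolding F_def[symmetric]
  proof (rule order_tendstoI)
    fix l :: real assume l: "l < 1"
    \<comment> \<open>Strictly between \<open>l\<close> and 1, and truncated at 0 so that
      \<open>b \<le> 1\<close>. The ramp starting at \<open>a = exp (- 1)\<close> lives on
      \<open>u \<le> t\<close> and has integral at least \<open>l'\<close>.\<close>
    define l' where "l' = max 0 ((l + 1) / 2)"
    have l': "l < l'" "0 \<le> l'" "l' < 1"
      using l by (auto simp: l'_def max_def field_simps)
    define a b :: real where "a = exp (- 1)" and "b = exp (- l')"
    have ab: "0 < a" "a < b" "b \<le> 1"
      using l' by (auto simp: a_def b_def)
    note K = karamata_continuous[OF meas nonneg int lim ramp_cont[OF ab(1,2)]]
    have "l < integral {0..1} (ramp a b)"
      using ramp_integral(1)[OF ab] l' by (simp add: b_def)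
    then have "eventually (\<lambda>t. l < (LINT x|N. exp (- u x / t) * ramp a b (exp (- u x / t))) / t) at_top"
      using order_tendstoD(1)[OF K(2)] by simp
    then show "eventually (\<lambda>t. l < F t / t) at_top"
      using eventually_gt_at_top[of 0]
    proof eventually_elim
      case (elim t)
      have "(LINT x|N. exp (- u x / t) * ramp a b (exp (- u x / t))) \<le> F t"
        unfolding F
      proof (intro integral_mono F_int)
        show "integrable N (\<lambda>x. exp (- u x / t) * ramp a b (exp (- u x / t)))"
          using K(1) elim by simp
        fix x assume "x \<in> space N"
        then show "exp (- u x / t) * ramp a b (exp (- u x / t)) \<le> indicator {x \<in> space N. u x \<le> t} x"
          using ramp_mult_le[OF ab(1,2), of "exp (- u x / t)"] elim
          by (auto simp: indicator_def a_def field_simps split: if_splits)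
      qed
      then show ?case
        using elim by (smt (verit) divide_right_mono)
    qed
  next
    fix l :: real assume l: "1 < l"
    \<comment> \<open>Now the ramp is complete at \<open>b = exp (- 1)\<close>, hence covers
      \<open>u \<le> t\<close>, and its integral is at most \<open>l'\<close>, which is below
      \<open>l\<close>.\<close>
    define l' where "l' = (l + 1) / 2"
    have l': "l' < l" "1 < l'"
      using l by (auto simp: l'_def)
    define a b :: real where "a = exp (- l')" and "b = exp (- 1)"
    have ab: "0 < a" "a < b" "b \<le> 1"
      using l' by (auto simp: a_def b_def)
    note K = karamata_continuous[OF meas nonneg int lim ramp_cont[OF ab(1,2)]]
    have "integral {0..1} (ramp a b) < l"
      using ramp_integral(2)[OF ab] l' by (simp add: a_def)
    then have "eventually (\<lambda>t. (LINT x|N. exp (- u x / t) * ramp a b (exp (- u x / t))) / t < l) at_top"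
      using order_tendstoD(2)[OF K(2)] by simp
    then show "eventually (\<lambda>t. F t / t < l) at_top"
      using eventually_gt_at_top[of 0]
    proof eventually_elim
      case (elim t)
      have "F t \<le> (LINT x|N. exp (- u x / t) * ramp a b (exp (- u x / t)))"
        unfolding F
      proof (intro integral_mono F_int)
        show "integrable N (\<lambda>x. exp (- u x / t) * ramp a b (exp (- u x / t)))"
          using K(1) elim by simp
        fix x assume "x \<in> space N"
        then show "indicator {x \<in> space N. u x \<le> t} x \<le> exp (- u x / t) * ramp a b (exp (- u x / t))"
          using ramp_mult_ge[OF ab(1,2), of "exp (- u x / t)"] ramp_nonneg[OF ab(1,2), of "exp (- u x / t)"] elim
          by (auto simp: indicator_def b_def field_simps split: if_splits)
      qed
      then show ?case
        using elim by (smt (verit) divide_right_mono)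
    qed
  qed
qed

subsection \<open>The logarithmic derivative\<close>

context balanced_series
begin

text \<open>Under the probability weights $c_i x^i / f(x)$ on the naturals, \<open>m x\<close> is the mean.\<close>

definition m where "m x = x * f' x / f x"

lemma m_measurable [measurable]: "m \<in> borel_measurable borel"
  unfolding m_def[abs_def] by measurable

lemma f'_nonneg: "0 \<le> x \<Longrightarrow> 0 \<le> f' x"
  unfolding f'_def using c_pos
  by (intro suminf_nonneg summable_diffs_c) (simp add: diffs_def less_imp_le)

lemma m_nonneg: "0 \<le> x \<Longrightarrow> 0 \<le> m x"
  unfolding m_def using f'_nonneg f_pos by (simp add: less_imp_le)

lemma f_ge_term: "0 \<le> x \<Longrightarrow> c j * x ^ j \<le> f x"
  using sum_le_suminf[OF summable_c[of x], of "{j}"] c_pos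
  by (simp add: f_eq less_imp_le)

text \<open>The fundamental theorem of calculus for \<open>x ^ Suc i / f x\<close> on [0, n];
  differentiating \<open>1 / f\<close> produces the factor \<open>m\<close>.\<close>

lemma integral_by_parts:
  fixes n :: nat
  shows "(LINT x|M. indicator {..real n} x * (x ^ i * m x))
    = real (Suc i) * (LINT x|M. indicator {..real n} x * x ^ i) - real n ^ Suc i / f (real n)"
    and "integrable M (\<lambda>x. indicator {..real n} x * (x ^ i * m x))"
proof -
  define G where "G x = x ^ Suc i / f x" for x
  define D where "D x = (real (Suc i) * x ^ i - x ^ i * m x) / f x" for x
  have fp: "f x \<noteq> 0" if "0 \<le> x" for x
    using f_pos[OF that] by simp
  have DG: "(G has_real_derivative D x) (at x)" if "0 \<le> x" for x
  proof -
    have "((\<lambda>x. x ^ Suc i) has_real_derivative real (Suc i) * x ^ i) (at x)"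
      using DERIV_pow[of "Suc i" x] by simp
    from DERIV_divide[OF this DERIV_f fp[OF that]] show ?thesis
      unfolding G_def D_def m_def using fp[OF that] by (simp add: field_simps)
  qed
  have D_cont: "isCont D x" if "0 \<le> x" for x
    unfolding D_def m_def using fp[OF that] cont_f[of UNIV] cont_f'[of UNIV]
    by (auto intro!: continuous_intros simp: continuous_on_eq_continuous_at)
  have 1: "has_bochner_integral lborel (\<lambda>x. D x * indicator {0..real n} x) (G n - G 0)"
    by (intro has_bochner_integral_FTC_Icc_real DG D_cont) auto
  have iM: "integrable M (\<lambda>x. indicator {..real n} x * x ^ i)"
    by (rule Bochner_Integration.integrable_bound[OF integrable_power[of i]])
       (auto simp: indicator_def)
  have "(\<lambda>x. indicator {0<..} x / f x * (real (Suc i) * (indicator {..real n} x * x ^ i) - indicator {..real n} x * (x ^ i * m x)))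
      = (\<lambda>x. indicator {0<..} x * (D x * indicator {0..real n} x))"
    by (auto simp: D_def indicator_def fun_eq_iff algebra_simps add_divide_distrib diff_divide_distrib)
  moreover have "has_bochner_integral lborel (\<lambda>x. indicator {0<..} x * (D x * indicator {0..real n} x)) (G n - G 0)"
  proof (subst has_bochner_integral_cong_AE)
    show "AE x in lborel. indicator {0<..} x * (D x * indicator {0..real n} x) = D x * indicator {0..real n} x"
      using AE_lborel_singleton[of 0] by eventually_elim (auto simp: indicator_def)
    show "has_bochner_integral lborel (\<lambda>x. D x * indicator {0..real n} x) (G n - G 0)"
      by (rule 1)
  qed (use 1 in \<open>auto simp: D_def\<close>)
  ultimately have 2: "integrable M (\<lambda>x. real (Suc i) * (indicator {..real n} x * x ^ i) - indicator {..real n} x * (x ^ i * m x))"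
    and 3: "(LINT x|M. real (Suc i) * (indicator {..real n} x * x ^ i) - indicator {..real n} x * (x ^ i * m x)) = G n - G 0"
    by (simp_all add: integrable_M integral_M has_bochner_integral_iff)
  have "integrable M (\<lambda>x. real (Suc i) * (indicator {..real n} x * x ^ i)
      - (real (Suc i) * (indicator {..real n} x * x ^ i) - indicator {..real n} x * (x ^ i * m x)))"
    by (intro Bochner_Integration.integrable_diff integrable_mult_right iM 2)
  then show int: "integrable M (\<lambda>x. indicator {..real n} x * (x ^ i * m x))"
    by simp
  have "real (Suc i) * (LINT x|M. indicator {..real n} x * x ^ i) - (LINT x|M. indicator {..real n} x * (x ^ i * m x)) = G n - G 0"
    unfolding 3[symmetric] using int iM
    by (subst Bochner_Integration.integral_diff) (auto intro!: integrable_mult_right)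
  then show "(LINT x|M. indicator {..real n} x * (x ^ i * m x))
    = real (Suc i) * (LINT x|M. indicator {..real n} x * x ^ i) - real n ^ Suc i / f (real n)"
    by (simp add: G_def)
qed

text \<open>Let \<open>n\<close> tend to infinity in \<open>integral_by_parts\<close>. The boundary
  term vanishes because \<open>f x\<close> is at least its term of degree \<open>i + 2\<close>;
  monotone convergence handles the integral with \<open>m \<ge> 0\<close>.\<close>

lemma integrable_power_m: "integrable M (\<lambda>x. x ^ i * m x)"
  and integral_power_m: "(LINT x|M. x ^ i * m x) = real (Suc i) * (LINT x|M. x ^ i)"
proof -
  have "(\<lambda>n. LINT x|M. indicator {..real n} x * x ^ i) \<longlonglongrightarrow> (LINT x|M. x ^ i)"
  proof (rule integral_dominated_convergence[OF _ _ integrable_power[of i, THEN integrable_abs]])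
    show "AE x in M. (\<lambda>n. indicator {..real n} x * x ^ i) \<longlonglongrightarrow> x ^ i"
    proof (intro AE_I2 tendsto_eventually)
      fix x :: real
      have "eventually (\<lambda>n. nat \<lceil>x\<rceil> \<le> n) sequentially"
        by (rule eventually_ge_at_top)
      then show "eventually (\<lambda>n. indicator {..real n} x * x ^ i = x ^ i) sequentially"
        proof eventually_elim
        case (elim n)
        then have "x \<le> real n"
          by linarith
        then show ?case
          by simp
      qed
    qed
  qed (auto simp: indicator_def)
  moreover have "(\<lambda>n. real n ^ Suc i / f (real n)) \<longlonglongrightarrow> 0"
  proof (rule tendsto_sandwich[OF _ _ tendsto_const])
    show "eventually (\<lambda>n. 0 \<le> real n ^ Suc i / f (real n)) sequentially"
      using f_pos by (auto simp: less_imp_le)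
    show "eventually (\<lambda>n. real n ^ Suc i / f (real n) \<le> inverse (c (Suc (Suc i))) * inverse (real n)) sequentially"
      using eventually_gt_at_top[of 0]
    proof eventually_elim
      case (elim n)
      have "real n ^ Suc i / f (real n) \<le> real n ^ Suc i / (c (Suc (Suc i)) * real n ^ Suc (Suc i))"
        using elim f_ge_term[of "real n" "Suc (Suc i)"] c_pos[of "Suc (Suc i)"] f_pos[of "real n"]
        by (intro divide_left_mono mult_pos_pos) auto
      also have "\<dots> = inverse (c (Suc (Suc i))) * inverse (real n)"
        using elim c_pos[of "Suc (Suc i)"] by (simp add: field_simps)
      finally show ?case .
    qed
    show "(\<lambda>n. inverse (c (Suc (Suc i))) * inverse (real n)) \<longlonglongrightarrow> 0"
      by (intro tendsto_mult_right_zero lim_inverse_n)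
  qed
  ultimately have lim: "(\<lambda>n. LINT x|M. indicator {..real n} x * (x ^ i * m x)) \<longlonglongrightarrow> real (Suc i) * (LINT x|M. x ^ i)"
    unfolding integral_by_parts using tendsto_diff[OF tendsto_mult_left] by fastforce
  have mono: "AE x in M. mono (\<lambda>n. indicator {..real n} x * (x ^ i * m x))"
    using AE_M_pos
  proof eventually_elim
    case (elim x)
    then have "0 \<le> x ^ i * m x"
      using m_nonneg[of x] by simp
    then show ?case
      by (auto simp: mono_def indicator_def)
  qed
  have ptw: "AE x in M. (\<lambda>n. indicator {..real n} x * (x ^ i * m x)) \<longlonglongrightarrow> x ^ i * m x"
  proof (intro AE_I2 tendsto_eventually)
    fix x :: real
    have "eventually (\<lambda>n. nat \<lceil>x\<rceil> \<le> n) sequentially"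
      by (rule eventually_ge_at_top)
    then show "eventually (\<lambda>n. indicator {..real n} x * (x ^ i * m x) = x ^ i * m x) sequentially"
    proof eventually_elim
      case (elim n)
      then have "x \<le> real n"
        by linarith
      then show ?case
        by simp
    qed
  qed
  show "integrable M (\<lambda>x. x ^ i * m x)"
    by (rule integrable_monotone_convergence[OF integral_by_parts(2) mono ptw lim]) simp
  show "(LINT x|M. x ^ i * m x) = real (Suc i) * (LINT x|M. x ^ i)"
    by (rule integral_monotone_convergence[OF integral_by_parts(2) mono ptw lim]) simp
qed

text \<open>The tangent inequality for the convex function \<open>ln f\<close> of the variable
  \<open>ln x\<close>. Termwise it is \<open>exp w \<ge> 1 + w\<close> at
  \<open>w = (i - m x) * z\<close>; the linear part sums to zero since \<open>m x\<close> is the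
  mean of \<open>i\<close>.\<close>

lemma f_convex:
  assumes "0 < x" "0 < y"
  shows "f x * exp (m x * ln (y / x)) \<le> f y"
proof -
  define z where "z = ln (y / x)"
  have y: "y = x * exp z"
    using assms by (simp add: z_def)
  have "(\<lambda>i. exp (m x * z) * ((1 - m x * z) * (c i * x ^ i) + z * (c i * real i * x ^ i)))
      sums (exp (m x * z) * ((1 - m x * z) * f x + z * (x * f' x)))"
    by (intro sums_mult sums_add series x_f'_sums)
  moreover have "(1 - m x * z) * f x + z * (x * f' x) = f x"
    using f_pos[of x] assms by (simp add: m_def field_simps)
  moreover have "exp (m x * z) * ((1 - m x * z) * (c i * x ^ i) + z * (c i * real i * x ^ i)) \<le> c i * y ^ i" for i
  proof -
    have "exp (m x * z) * (1 + (real i * z - m x * z)) \<le> exp (m x * z) * exp (real i * z - m x * z)"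
      by (intro mult_left_mono exp_ge_add_one_self) simp
    also have "\<dots> = exp z ^ i"
      by (simp add: exp_add[symmetric] exp_of_nat_mult)
    finally have "c i * x ^ i * (exp (m x * z) * (1 + (real i * z - m x * z))) \<le> c i * x ^ i * exp z ^ i"
      using c_pos[of i] assms by (intro mult_left_mono) auto
    then show ?thesis
      by (simp add: y algebra_simps power_mult_distrib)
  qed
  ultimately show ?thesis
    using sums_le[OF _ _ series[of y]] by (fastforce simp: z_def mult.commute)
qed

text \<open>Multiply the tangent inequalities at \<open>x\<close> and at \<open>y\<close>: slopes of
  a convex function increase.\<close>

lemma m_mono:
  assumes "0 < x" "x \<le> y"
  shows "m x \<le> m y"
proof (cases "x = y")
  case False
  with assms have xy: "0 < y" "0 < ln (y / x)" "ln (x / y) = - ln (y / x)"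
    by (auto simp: ln_div)
  have "f x * exp (m x * ln (y / x)) * exp (m y * ln (x / y)) \<le> f y * exp (m y * ln (x / y))"
    using f_convex[OF assms(1) xy(1)] by (intro mult_right_mono) auto
  also have "\<dots> \<le> f x"
    using f_convex[OF xy(1) assms(1)] .
  finally have "exp ((m x - m y) * ln (y / x)) \<le> 1"
    using f_pos[of x] assms xy by (simp add: mult.assoc exp_add[symmetric] algebra_simps)
  then show ?thesis
    using xy by (simp add: mult_le_0_iff)
qed simp

text \<open>Tangents at the two ends: the one at \<open>x\<close> evaluated at \<open>s * x\<close>,
  and the one at \<open>s * x\<close> evaluated at \<open>x\<close>.\<close>

lemma m_powr_bounds:
  assumes "0 < s" "s < 1" "0 < x"
  shows "exp (m x * ln s) \<le> f (s * x) / f x"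
    and "f (s * x) / f x \<le> exp (m (s * x) * ln s)"
proof -
  have sx: "0 < s * x" "0 < f x" "0 < f (s * x)"
    using assms f_pos by auto
  show "exp (m x * ln s) \<le> f (s * x) / f x"
    using f_convex[of x "s * x"] assms sx by (simp add: field_simps)
  have "f (s * x) * exp (- (m (s * x) * ln s)) \<le> f x"
    using f_convex[of "s * x" x] assms sx by (simp add: ln_div)
  then show "f (s * x) / f x \<le> exp (m (s * x) * ln s)"
    using sx by (simp add: exp_minus field_simps)
qed

section \<open>Laplace transform of \<open>m\<close> and its linear growth\<close>

definition L where "L = restrict_space lborel {0::real<..}"

text \<open>For \<open>s = exp (- 1 / t)\<close>, \<open>exp (m x * ln s)\<close> is the exponential
  in question, and \<open>m_powr_bounds\<close> compares it with the integrand of the functional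
  equation. The bound involving \<open>m (s * x)\<close> needs the substitution
  \<open>s * x\<close>, which costs a factor \<open>s\<close>. Finally \<open>1 / (1 - s)\<close>
  lies between \<open>t\<close> and \<open>t + 1\<close>.\<close>

lemma integral_exp_m:
  assumes t: "0 < t"
  shows "integrable L (\<lambda>x. exp (- m x / t))"
    and "(LINT x|L. exp (- m x / t)) \<le> t + 1"
    and "1 \<le> t \<Longrightarrow> (1 - 1 / t) * (t - 1) \<le> (LINT x|L. exp (- m x / t))"
proof -
  define s where "s = exp (- 1 / t)"
  have s: "0 < s" "s < 1" and ln_s: "ln s = - 1 / t"
    using t by (auto simp: s_def)
  have "1 - 1 / t \<le> s"
    using exp_ge_add_one_self[of "- 1 / t"] by (simp add: s_def)
  have "1 + 1 / t \<le> 1 / s"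
    using exp_ge_add_one_self[of "1 / t"] by (simp add: s_def exp_minus field_simps)
  have up: "1 / (1 - s) \<le> t + 1"
    using \<open>1 + 1 / t \<le> 1 / s\<close> s t by (simp add: field_simps)
  have lo: "t \<le> 1 / (1 - s)"
    using \<open>1 - 1 / t \<le> s\<close> s t by (simp add: field_simps)
  define w where "w x = indicator {0<..} x * exp (- m x / t)" for x :: real
  have w_eq: "w x = indicator {0<..} x * exp (m x * ln s)" for x
    by (simp add: w_def ln_s)
  have [measurable]: "w \<in> borel_measurable borel"
    unfolding w_def[abs_def] by measurable
  have int: "has_bochner_integral lborel (\<lambda>x. indicator {0<..} x / f x * f (s * x)) (1 / (1 - s) - \<beta>)"
    using has_bochner_M_f[of s] s by (simp add: has_bochner_integral_iff integrable_M integral_M)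
  have w_int: "integrable lborel w"
  proof (rule Bochner_Integration.integrable_bound)
    show "integrable lborel (\<lambda>x. indicator {0<..} x / f x * f (s * x))"
      using int by (simp add: has_bochner_integral_iff)
    show "AE x in lborel. norm (w x) \<le> norm (indicator {0<..} x / f x * f (s * x))"
    proof (intro AE_I2)
      fix x :: real
      show "norm (w x) \<le> norm (indicator {0<..} x / f x * f (s * x))"
        using m_powr_bounds(1)[OF s, of x] f_pos[of x] f_pos[of "s * x"] s
        by (cases "0 < x") (auto simp: w_eq)
    qed
  qed simp
  have w_le: "(LINT x|lborel. w x) \<le> 1 / (1 - s) - \<beta>"
  proof -
    have "(LINT x|lborel. w x) \<le> (LINT x|lborel. indicator {0<..} x / f x * f (s * x))"
      using int m_powr_bounds(1)[OF s] w_int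
      by (intro integral_mono) (force simp: w_eq indicator_def has_bochner_integral_iff)+
    then show ?thesis
      using int by (simp add: has_bochner_integral_iff)
  qed
  have w_ge: "1 / (1 - s) - \<beta> \<le> (LINT x|lborel. w x) / s"
  proof -
    have "integrable lborel (\<lambda>x. w (0 + s * x))"
      using lborel_integrable_real_affine[OF w_int, of s 0] s by simp
    then have "(LINT x|lborel. indicator {0<..} x / f x * f (s * x)) \<le> (LINT x|lborel. w (0 + s * x))"
      using int m_powr_bounds(2)[OF s] s
      by (intro integral_mono) (force simp: w_eq indicator_def has_bochner_integral_iff zero_less_mult_iff)+
    moreover have "(LINT x|lborel. w x) = s * (LINT x|lborel. w (0 + s * x))"
      using lborel_integral_real_affine[of s w 0] s by simp
    ultimately show ?thesis
      using int s by (simp add: has_bochner_integral_iff)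
  qed
  have L_int: "(LINT x|L. exp (- m x / t)) = (LINT x|lborel. w x)"
    unfolding L_def w_def by (subst integral_restrict_space) auto
  show "integrable L (\<lambda>x. exp (- m x / t))"
    using w_int unfolding L_def w_def[abs_def] by (subst integrable_restrict_space) auto
  show "(LINT x|L. exp (- m x / t)) \<le> t + 1"
    using w_le up beta L_int by linarith
  assume "1 \<le> t"
  then have "(1 - 1 / t) * (t - 1) \<le> s * (1 / (1 - s) - \<beta>)"
    using lo beta s t \<open>1 - 1 / t \<le> s\<close> by (intro mult_mono) auto
  also have "\<dots> \<le> (LINT x|lborel. w x)"
    using w_ge s by (simp add: field_simps)
  finally show "(1 - 1 / t) * (t - 1) \<le> (LINT x|L. exp (- m x / t))"
    using L_int by simp
qed

text \<open>Karamata gives \<open>F t\<close> asymptotic to \<open>t\<close> for the measure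
  \<open>F t\<close> of the sublevel set. As \<open>m\<close> is increasing, sublevel sets are
  initial intervals and \<open>F\<close> acts as its inverse function, so the estimate can be
  inverted.\<close>

lemma m_asymptotically_linear:
  assumes eps: "0 < \<epsilon>" "\<epsilon> < 1"
  obtains T where "0 < T" "\<And>x. 0 < x \<Longrightarrow> x \<le> (1 + \<epsilon>) * m x + T"
    "\<And>x. 0 < x \<Longrightarrow> (1 - \<epsilon>) * m x \<le> x + T"
proof -
  have [measurable]: "m \<in> borel_measurable L"
    unfolding L_def by (rule measurable_restrict_space1) simp
  have nonneg: "0 \<le> m x" if "x \<in> space L" for x
    using that m_nonneg by (auto simp: L_def space_restrict_space)
  have "((\<lambda>t. (LINT x|L. exp (- m x / t)) / t) \<longlongrightarrow> 1) at_top"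
  proof (rule tendsto_sandwich)
    show "eventually (\<lambda>t. (1 - 1 / t) * (1 - 1 / t) \<le> (LINT x|L. exp (- m x / t)) / t) at_top"
      using eventually_gt_at_top[of 1]
    proof eventually_elim
      case (elim t)
      then have "(1 - 1 / t) * (1 - 1 / t) = (1 - 1 / t) * (t - 1) / t"
        by (simp add: field_simps)
      also have "\<dots> \<le> (LINT x|L. exp (- m x / t)) / t"
        using elim integral_exp_m(3)[of t] by (intro divide_right_mono) auto
      finally show ?case .
    qed
    show "eventually (\<lambda>t. (LINT x|L. exp (- m x / t)) / t \<le> 1 + 1 / t) at_top"
      using eventually_gt_at_top[of 0]
    proof eventually_elim
      case (elim t)
      then show ?case
        using integral_exp_m(2)[of t] by (simp add: field_simps)
    qed
    have 0: "((\<lambda>t::real. 1 / t) \<longlongrightarrow> 0) at_top"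
      by (rule tendsto_divide_0[OF tendsto_const filterlim_at_top_imp_at_infinity[OF filterlim_ident]])
    show "((\<lambda>t::real. (1 - 1 / t) * (1 - 1 / t)) \<longlongrightarrow> 1) at_top"
      using tendsto_mult[OF tendsto_diff[OF tendsto_const[of 1] 0] tendsto_diff[OF tendsto_const[of 1] 0]] by simp
    show "((\<lambda>t::real. 1 + 1 / t) \<longlongrightarrow> 1) at_top"
      using tendsto_add[OF tendsto_const[of 1] 0] by simp
  qed
  note K = karamata_tauberian[OF \<open>m \<in> borel_measurable L\<close> nonneg integral_exp_m(1) this]
  define F where "F t = measure L {x \<in> space L. m x \<le> t}" for t
  have "eventually (\<lambda>t. 1 - \<epsilon> < F t / t \<and> F t / t < 1 + \<epsilon>) at_top"
    using order_tendstoD[OF K(2), folded F_def] eps by (intro eventually_conj) auto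
  then obtain T0 where T0: "T0 > 0" "\<And>t. T0 \<le> t \<Longrightarrow> (1 - \<epsilon>) * t \<le> F t \<and> F t \<le> (1 + \<epsilon>) * t"
  proof -
    obtain T1 where T1: "\<And>t. T1 \<le> t \<Longrightarrow> 1 - \<epsilon> < F t / t \<and> F t / t < 1 + \<epsilon>"
      using \<open>eventually _ at_top\<close> by (auto simp: eventually_at_top_linorder)
    have "(1 - \<epsilon>) * t \<le> F t \<and> F t \<le> (1 + \<epsilon>) * t" if "max 1 T1 \<le> t" for t
      using T1[of t] that by (simp add: field_simps less_imp_le)
    then show thesis
      using that[of "max 1 T1"] by simp
  qed
  have measL: "measure L {0<..x} = x" if "0 < x" for x
    using that unfolding L_def by (subst measure_restrict_space) (auto simp: subset_eq)
  have F_ge: "x \<le> F t" if "0 < x" "m x \<le> t" for x t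
  proof -
    have "{0<..x} \<subseteq> {y \<in> space L. m y \<le> t}"
      using that m_mono by (force simp: L_def space_restrict_space)
    then have "measure L {0<..x} \<le> F t"
      unfolding F_def using K(1)[of t]
      by (intro measure_mono_fmeasurable) (auto simp: fmeasurable_def L_def sets_restrict_space_iff subset_eq)
    then show ?thesis
      using measL that by simp
  qed
  have F_le: "F t \<le> x" if "0 < x" "t < m x" for x t
  proof -
    have "{y \<in> space L. m y \<le> t} \<subseteq> {0<..x}"
    proof
      fix y assume "y \<in> {y \<in> space L. m y \<le> t}"
      then show "y \<in> {0<..x}"
        using that m_mono[of x y] by (force simp: L_def space_restrict_space)
    qed
    moreover have "emeasure lborel {0<..x} < \<infinity>"
      using that by (simp add: emeasure_lborel_Ioc)
    ultimately have "F t \<le> measure L {0<..x}"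
      unfolding F_def
      by (intro measure_mono_fmeasurable)
         (auto simp: fmeasurable_def L_def sets_restrict_space_iff subset_eq emeasure_restrict_space)
    then show ?thesis
      using measL that by simp
  qed
  show thesis
  \<comment> \<open>Below the threshold \<open>T0\<close> nothing is known about \<open>F\<close>;
    the additive constant pays for that range.\<close>
  proof (rule that[of "(1 + \<epsilon>) * T0"])
    show "0 < (1 + \<epsilon>) * T0"
      using T0 eps by simp
    show "x \<le> (1 + \<epsilon>) * m x + (1 + \<epsilon>) * T0" if x: "0 < x" for x
    proof -
      have "x \<le> (1 + \<epsilon>) * max T0 (m x)"
        using F_ge[of x "max T0 (m x)"] T0(2)[of "max T0 (m x)"] x by simp
      also have "\<dots> \<le> (1 + \<epsilon>) * (m x + T0)"
        using m_nonneg[of x] x T0 eps by (intro mult_left_mono) auto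
      finally show ?thesis
        by (simp add: algebra_simps)
    qed
    show "(1 - \<epsilon>) * m x \<le> x + (1 + \<epsilon>) * T0" if x: "0 < x" for x
    proof (cases "m x \<le> T0")
      case True
      then have "(1 - \<epsilon>) * m x \<le> (1 + \<epsilon>) * T0"
        using eps m_nonneg[of x] x by (intro mult_mono) auto
      then show ?thesis
        using x by simp
    next
      case False
      \<comment> \<open>\<open>F_le\<close> requires \<open>t < m x\<close> strictly, so the bound
        on \<open>m x\<close> is reached by density from below.\<close>
      have "t \<le> x / (1 - \<epsilon>)" if "T0 < t" "t < m x" for t
        using T0(2)[of t] F_le[of x t] that x eps by (simp add: field_simps)
      then have "m x \<le> x / (1 - \<epsilon>)"
        using False by (metis dense_le_bounded linorder_le_less_linear)
      then have "(1 - \<epsilon>) * m x \<le> x"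
        using eps by (simp add: field_simps)
      moreover have "0 \<le> (1 + \<epsilon>) * T0"
        using T0 eps by simp
      ultimately show ?thesis
        by linarith
    qed
  qed
qed

section \<open>Coefficient ratios and the maximum principle\<close>

definition r where "r n = (case n of 0 \<Rightarrow> 0 | Suc k \<Rightarrow> c k / c (Suc k))"

lemma r_0 [simp]: "r 0 = 0"
  by (simp add: r_def)

text \<open>Multiplication by \<open>x\<close> shifts the series by one index. The value
  \<open>r 0 = 0\<close> amounts to a vanishing coefficient of index -1 and lets the sum start at
  0.\<close>

lemma r_sums: "(\<lambda>i. c i * r i * x ^ i) sums (x * f x)"
proof -
  have "(\<lambda>i. x * (c i * x ^ i)) sums (x * f x)"
    by (intro sums_mult series)
  moreover have "x * (c i * x ^ i) = c (Suc i) * r (Suc i) * x ^ Suc i" for i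
    using c_pos[of "Suc i"] by (simp add: r_def)
  ultimately have "(\<lambda>i. c (Suc i) * r (Suc i) * x ^ Suc i) sums (x * f x)"
    by simp
  then show ?thesis
    by (subst (asm) sums_Suc_iff) simp
qed

lemma m_sums: "0 \<le> x \<Longrightarrow> (\<lambda>i. c i * real i * x ^ i) sums (m x * f x)"
  using x_f'_sums[of x] f_pos[of x] by (simp add: m_def)

text \<open>The integral is the moment of order \<open>Suc i\<close>, that is
  \<open>1 / c (Suc i)\<close>.\<close>

lemma mean_power: "c i * (LINT x|M. x ^ i * x) = r (Suc i)"
proof -
  have "c (Suc i) * (LINT x|M. x ^ i * x) = 1"
    using moment[of "Suc i"] by (simp add: \<tau>_def mult.commute)
  then show ?thesis
    using c_pos[of "Suc i"] by (simp add: r_def field_simps)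
qed

lemma mean_m: "c i * (LINT x|M. x ^ i * m x) = real (Suc i) * \<tau> i"
  using moment[of i] by (simp add: integral_power_m)

lemma integrable_power_lin: "integrable M (\<lambda>x. x ^ i * (p * x + q * m x + v))"
proof -
  have "integrable M (\<lambda>x. p * x ^ Suc i + q * (x ^ i * m x) + v * x ^ i)"
    by (intro Bochner_Integration.integrable_add integrable_mult_right integrable_power integrable_power_m)
  then show ?thesis
    by (simp add: algebra_simps)
qed

lemma mean_lin: "c i * (LINT x|M. x ^ i * (p * x + q * m x + v)) = p * r (Suc i) + (q * real (Suc i) + v) * \<tau> i"
proof -
  have "(LINT x|M. x ^ i * (p * x + q * m x + v)) = (LINT x|M. p * (x ^ i * x) + q * (x ^ i * m x) + v * x ^ i)"
    by (simp add: algebra_simps)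
  also have "\<dots> = p * (LINT x|M. x ^ i * x) + q * (LINT x|M. x ^ i * m x) + v * (LINT x|M. x ^ i)"
    using integrable_power[of "Suc i"] integrable_power_m[of i] integrable_power[of i]
    by (simp add: mult.commute)
  finally show ?thesis
    using mean_power[of i] mean_m[of i] moment[of i] by (simp add: algebra_simps)
qed

text \<open>With $p_i(x) = c_i x^i / f(x)$ and $b_n = p r_n + q n$, averaging $b$ over the weights
  $p_i(x)$ gives $B(x) = p x + q m(x)$, and averaging $B$ over the density $p_i$ returns
  $b_{i+1}$, up to a boundary term at $i = 0$. Hence $b$ has no positive maximum.\<close>

lemma no_maximum:
  assumes V: "0 < V" "q \<le> V" and le: "\<And>n. p * r n + q * real n \<le> V"
  shows "p * r n + q * real n < V"
proof (cases n)
  case 0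
  then show ?thesis
    using V by simp
next
  case (Suc i)
  \<comment> \<open>First averaging: the sum has nonnegative terms, and strictness comes from index
    0, where \<open>r 0 = 0\<close> leaves \<open>V > 0\<close>.\<close>
  have pos: "0 < - p * x + - q * m x + V" if x: "0 < x" for x
  proof -
    have "(\<lambda>i. V * (c i * x ^ i) - p * (c i * r i * x ^ i) - q * (c i * real i * x ^ i))
        sums (V * f x - p * (x * f x) - q * (m x * f x))"
      using x by (intro sums_diff sums_mult series r_sums m_sums) auto
    then have sums: "(\<lambda>i. (V - (p * r i + q * real i)) * (c i * x ^ i)) sums (f x * (- p * x + - q * m x + V))"
      by (simp add: algebra_simps)
    have "0 < (V - (p * r 0 + q * real 0)) * (c 0 * x ^ 0)"
      using V by (simp add: c_0)
    also have "\<dots> = (\<Sum>i\<in>{0}. (V - (p * r i + q * real i)) * (c i * x ^ i))"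
      by simp
    also have "\<dots> \<le> f x * (- p * x + - q * m x + V)"
      unfolding sums_unique[OF sums] using le c_pos x
      by (intro sum_le_suminf sums_summable[OF sums]) (auto simp: less_imp_le)
    finally show ?thesis
      using f_pos[of x] x by (simp add: zero_less_mult_iff)
  qed
  \<comment> \<open>Second averaging, over \<open>x\<close>; \<open>M\<close> has the positive mass
    \<open>1 - \<beta>\<close>, so the inequality stays strict.\<close>
  have "(LINT x|M. 0) < (LINT x|M. x ^ i * (- p * x + - q * m x + V))"
  proof (rule integral_less_AE_space)
    show "AE x in M. 0 < x ^ i * (- p * x + - q * m x + V)"
      using AE_M_pos
    proof eventually_elim
      case (elim x)
      with pos[OF this] show ?case
        by (intro mult_pos_pos) auto
    qed
    have "measure M (space M) \<noteq> 0"
      using integral_M_1 beta by simp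
    then show "emeasure M (space M) \<noteq> 0"
      by (simp add: emeasure_eq_measure)
  qed (rule Bochner_Integration.integrable_zero integrable_power_lin)+
  then have "0 < c i * (LINT x|M. x ^ i * (- p * x + - q * m x + V))"
    using c_pos[of i] by simp
  then have *: "0 < - p * r (Suc i) + (- q * real (Suc i) + V) * \<tau> i"
    by (simp only: mean_lin)
  show ?thesis
  proof (cases "i = 0")
    case True
    \<comment> \<open>At \<open>i = 0\<close> the density has mass \<open>1 - \<beta>\<close> only;
      the defect \<open>\<beta> * (V - q)\<close> has the right sign because
      \<open>q \<le> V\<close>.\<close>
    have "\<beta> * q \<le> \<beta> * V"
      using V beta by (intro mult_left_mono) auto
    then show ?thesis
      using * True Suc by (simp add: \<tau>_def algebra_simps)
  next
    case False
    then show ?thesis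
      using * Suc by (simp add: \<tau>_def algebra_simps)
  qed
qed

text \<open>If the bound failed, the eventual bound would confine the supremum to finitely many
  indices, so it would be attained and exceed both 0 and \<open>q\<close>, against
  \<open>no_maximum\<close>.\<close>

lemma maximum_principle:
  assumes ev: "eventually (\<lambda>n. p * r n + q * real n \<le> max 0 q) sequentially"
  shows "p * r n + q * real n \<le> max 0 q"
proof (rule ccontr)
  assume n: "\<not> p * r n + q * real n \<le> max 0 q"
  define b where "b n = p * r n + q * real n" for n
  obtain k where k: "\<And>j. k \<le> j \<Longrightarrow> b j \<le> max 0 q"
    using ev by (auto simp: b_def eventually_sequentially)
  define V where "V = Max (b ` {..max n k})"
  have "b n \<le> V"
    unfolding V_def by (intro Max_ge) auto
  then have V: "max 0 q < V"
    using n unfolding b_def by linarith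
  have "b j \<le> V" for j
  proof (cases "j \<le> max n k")
    case True
    then show ?thesis
      unfolding V_def by (intro Max_ge) auto
  next
    case False
    then show ?thesis
      by (intro order_trans[OF k less_imp_le[OF V]]) simp
  qed
  then have "b j < V" for j
    using no_maximum[of V q p j] V by (simp add: b_def)
  moreover have "V \<in> b ` {..max n k}"
    unfolding V_def by (intro Max_in) auto
  ultimately show False
    by force
qed

text \<open>Averaging the linear estimates of \<open>m\<close> bounds \<open>r n\<close> for large
  \<open>n\<close> up to a factor \<open>1 \<plusminus> 2 * \<epsilon>\<close>; the maximum
  principle extends this to all \<open>n\<close>, and \<epsilon> tends to 0. For
  \<open>q = - (1 + 2 * \<epsilon>)\<close> the bound \<open>max 0 q\<close> is 0, for
  \<open>q = 1 - 2 * \<epsilon>\<close> it is at most 1: hence the asymmetry.\<close>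

lemma r_bounds: "real n - 1 \<le> r n" "r n \<le> real n"
proof -
  have *: "r n \<le> (1 + 2 * \<epsilon>) * real n \<and> (1 - 2 * \<epsilon>) * real n - r n \<le> 1" if eps: "0 < \<epsilon>" "\<epsilon> < 1" for n \<epsilon>
  proof -
    obtain T where T: "0 < T" "\<And>x. 0 < x \<Longrightarrow> x \<le> (1 + \<epsilon>) * m x + T"
        "\<And>x. 0 < x \<Longrightarrow> (1 - \<epsilon>) * m x \<le> x + T"
      using m_asymptotically_linear[OF eps] by blast
    have mean: "0 \<le> p * r (Suc i) + q * real (Suc i) + v"
      if "\<And>x. 0 < x \<Longrightarrow> 0 \<le> p * x + q * m x + v" "0 < i" for p q v i
    proof -
      have "0 \<le> (LINT x|M. x ^ i * (p * x + q * m x + v))"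
        using AE_M_pos that(1) by (intro integral_nonneg_AE) (auto elim!: eventually_mono)
      then have "0 \<le> c i * (LINT x|M. x ^ i * (p * x + q * m x + v))"
        using c_pos[of i] by simp
      then show ?thesis
        using that(2) by (simp add: mean_lin \<tau>_def)
    qed
    \<comment> \<open>Such \<open>n\<close> absorb \<open>T\<close> into a second \<epsilon>, and
      \<open>n \<ge> 2\<close> gives \<open>n = Suc i\<close> with \<open>i > 0\<close>, where the
      density has mass 1.\<close>
    have large: "eventually (\<lambda>n. T \<le> \<epsilon> * real n \<and> 2 \<le> n) sequentially"
    proof (intro eventually_conj eventually_ge_at_top)
      have "eventually (\<lambda>n. T / \<epsilon> \<le> real n) sequentially"
        using filterlim_real_sequentially by (simp add: filterlim_at_top)
      then show "eventually (\<lambda>n. T \<le> \<epsilon> * real n) sequentially"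
        by eventually_elim (use eps in \<open>simp add: field_simps\<close>)
    qed
    have "eventually (\<lambda>n. 1 * r n + - (1 + 2 * \<epsilon>) * real n \<le> max 0 (- (1 + 2 * \<epsilon>))) sequentially"
      using large
    proof eventually_elim
      case (elim n)
      then obtain i where "n = Suc i" "0 < i"
        by (cases n) auto
      then have "1 * r n + - (1 + 2 * \<epsilon>) * real n \<le> 0"
        using mean[of "-1" "1 + \<epsilon>" T i] T(2) elim by (simp add: algebra_simps)
      then show ?case
        by (rule order_trans[OF _ max.cobounded1])
    qed
    from maximum_principle[OF this] have 1: "r n \<le> (1 + 2 * \<epsilon>) * real n"
      using eps by (simp add: max_def algebra_simps split: if_splits)
    have "eventually (\<lambda>n. (- 1) * r n + (1 - 2 * \<epsilon>) * real n \<le> max 0 (1 - 2 * \<epsilon>)) sequentially"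
      using large
    proof eventually_elim
      case (elim n)
      then obtain i where "n = Suc i" "0 < i"
        by (cases n) auto
      then have "(- 1) * r n + (1 - 2 * \<epsilon>) * real n \<le> 0"
        using mean[of 1 "- (1 - \<epsilon>)" T i] T(3) elim by (simp add: algebra_simps)
      then show ?case
        by (rule order_trans[OF _ max.cobounded1])
    qed
    from maximum_principle[OF this] have "(1 - 2 * \<epsilon>) * real n - r n \<le> max 0 (1 - 2 * \<epsilon>)"
      by simp
    also have "\<dots> \<le> 1"
      using eps by simp
    finally show ?thesis
      using 1 by blast
  qed
  have small: "\<exists>\<epsilon>. 0 < \<epsilon> \<and> \<epsilon> < 1 \<and> 2 * \<epsilon> * real n \<le> e" if e: "0 < e" for e
  proof (intro exI conjI)
    define \<epsilon> where "\<epsilon> = min (1 / 2) (e / (2 * real n + 1))"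
    show "0 < \<epsilon>" "\<epsilon> < 1"
      using e by (simp_all add: \<epsilon>_def add_pos_nonneg)
    have "\<epsilon> * (2 * real n + 1) \<le> e"
      unfolding \<epsilon>_def by (subst pos_le_divide_eq[symmetric]) (simp_all add: add_pos_nonneg)
    then show "2 * \<epsilon> * real n \<le> e"
      using \<open>0 < \<epsilon>\<close> by (simp add: distrib_left mult_ac)
  qed
  show "r n \<le> real n"
  proof (rule field_le_epsilon)
    fix e :: real assume "0 < e"
    then obtain \<epsilon> where "0 < \<epsilon>" "\<epsilon> < 1" "2 * \<epsilon> * real n \<le> e"
      using small by blast
    then show "r n \<le> real n + e"
      using *[of \<epsilon> n] by (simp add: distrib_right)
  qed
  show "real n - 1 \<le> r n"
  proof (rule field_le_epsilon)
    fix e :: real assume "0 < e"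
    then obtain \<epsilon> where "0 < \<epsilon>" "\<epsilon> < 1" "2 * \<epsilon> * real n \<le> e"
      using small by blast
    then show "real n - 1 \<le> r n + e"
      using *[of \<epsilon> n] by (simp add: left_diff_distrib)
  qed
qed

text \<open>\<open>m x - x\<close> is the average of \<open>i - r i\<close>, a quantity between 0
  and 1 by \<open>r_bounds\<close>.\<close>

lemma m_minus_id_bounds:
  assumes "0 \<le> x"
  shows "x \<le> m x" "m x \<le> x + 1"
proof -
  have "(\<lambda>i. c i * real i * x ^ i - c i * r i * x ^ i) sums (m x * f x - x * f x)"
    using assms by (intro sums_diff m_sums r_sums)
  then have s: "(\<lambda>i. (real i - r i) * (c i * x ^ i)) sums ((m x - x) * f x)"
    by (simp add: algebra_simps)
  have cx: "0 \<le> c i * x ^ i" for i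
    using c_pos[of i] assms by simp
  have "0 \<le> (m x - x) * f x"
  proof (rule sums_le[OF _ sums_zero s])
    show "0 \<le> (real i - r i) * (c i * x ^ i)" for i
      using r_bounds[of i] cx by simp
  qed
  then show "x \<le> m x"
    using f_pos[OF assms] by (simp add: zero_le_mult_iff)
  have "(m x - x) * f x \<le> f x"
  proof (rule sums_le[OF _ s series])
    show "(real i - r i) * (c i * x ^ i) \<le> c i * x ^ i" for i
      using r_bounds[of i] cx mult_right_mono[of "real i - r i" 1 "c i * x ^ i"] by simp
  qed
  then show "m x \<le> x + 1"
    using f_pos[OF assms] by (simp add: mult_le_cancel_right1)
qed

subsection \<open>Logarithmic asymptotics\<close>

definition g where "g x = ln (f x) - x"

text \<open>The derivative of \<open>g\<close> is \<open>(m z - z) / z\<close>, between 0 and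
  \<open>1 / z\<close>; so \<open>g\<close> and \<open>ln - g\<close> are both
  nondecreasing.\<close>

lemma g_diff_bounds:
  assumes "0 < y" "y \<le> x"
  shows "g y \<le> g x" "g x - g y \<le> ln (x / y)"
proof -
  have deriv: "(g has_real_derivative (m z - z) / z) (at z)" if "0 < z" for z
    unfolding g_def m_def using that f_pos[of z]
    by (auto intro!: derivative_eq_intros DERIV_f simp: field_simps)
  show "g y \<le> g x"
  proof (rule DERIV_nonneg_imp_nondecreasing[OF assms(2)])
    fix z assume "y \<le> z" "z \<le> x"
    then show "\<exists>d. (g has_real_derivative d) (at z) \<and> 0 \<le> d"
      using assms deriv[of z] m_minus_id_bounds[of z] by (intro exI conjI) auto
  qed
  have "ln y - g y \<le> ln x - g x"
  proof (rule DERIV_nonneg_imp_nondecreasing[OF assms(2)])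
    fix z assume "y \<le> z" "z \<le> x"
    then have z: "0 < z"
      using assms by simp
    have "((\<lambda>z. ln z - g z) has_real_derivative (1 / z - (m z - z) / z)) (at z)"
      using z by (auto intro!: derivative_eq_intros deriv)
    then show "\<exists>d. ((\<lambda>z. ln z - g z) has_real_derivative d) (at z) \<and> 0 \<le> d"
      using z m_minus_id_bounds[of z] by (intro exI conjI) (auto simp: field_simps)
  qed
  then show "g x - g y \<le> ln (x / y)"
    using assms by (simp add: ln_div)
qed

lemma g_measurable [measurable]: "g \<in> borel_measurable borel"
  unfolding g_def[abs_def] by measurable

section \<open>Means of \<open>g\<close> under the standard exponential distribution\<close>

definition E where "E = density lborel (\<lambda>v. ennreal (indicator {0<..} v * exp (- v)))"

lemma sets_E [measurable_cong, simp]: "sets E = sets borel"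
  by (simp add: E_def)

lemma integrable_E:
  fixes h :: "real \<Rightarrow> real"
  assumes "h \<in> borel_measurable borel"
  shows "integrable E h \<longleftrightarrow> integrable lborel (\<lambda>v. indicator {0<..} v * exp (- v) * h v)"
  unfolding E_def using assms by (subst integrable_density) auto

lemma integral_E:
  fixes h :: "real \<Rightarrow> real"
  assumes "h \<in> borel_measurable borel"
  shows "(LINT v|E. h v) = (LINT v|lborel. indicator {0<..} v * exp (- v) * h v)"
  unfolding E_def using assms by (subst integral_density) auto

lemma AE_E_pos: "AE v in E. 0 < v"
  unfolding E_def by (subst AE_density) (auto simp: indicator_def)

text \<open>Euler's integral for Gamma; it serves at \<open>a = 1\<close> for the total mass and at
  \<open>a = 2\<close> and \<open>a = 1 / 2\<close> for \<open>ln_bound\<close>.\<close>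

lemma has_bochner_E_powr:
  assumes a: "0 < a"
  shows "has_bochner_integral E (\<lambda>v. v powr (a - 1)) (Gamma a)"
proof -
  have "(\<integral>\<^sup>+v. ennreal (v powr (a - 1) / exp v) * indicator {0..} v \<partial>lborel) = ennreal (Gamma a)"
    using Gamma_integral_real[OF a] by (intro nn_integral_has_integral_lebesgue') auto
  then have "(\<integral>\<^sup>+v. ennreal (v powr (a - 1) / exp v * indicator {0..} v) \<partial>lborel) = ennreal (Gamma a)"
    by (simp only: ennreal_mult'' ennreal_indicator indicator_pos_le)
  then have "has_bochner_integral lborel (\<lambda>v. v powr (a - 1) / exp v * indicator {0..} v) (Gamma a)"
    using Gamma_real_pos[OF a] by (intro has_bochner_integral_nn_integral) (auto simp: less_imp_le)
  moreover have "v powr (a - 1) / exp v * indicator {0..} v = indicator {0<..} v * exp (- v) * v powr (a - 1)" for v :: real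
    by (cases "v = 0") (auto simp: indicator_def exp_minus field_simps)
  ultimately show ?thesis
    by (simp add: has_bochner_integral_iff integrable_E integral_E)
qed

lemma integrable_E_1: "integrable E (\<lambda>v. 1::real)" and integral_E_1: "(LINT v|E. (1::real)) = 1"
proof -
  have "has_bochner_integral E (\<lambda>v. 1::real) 1"
  proof (subst has_bochner_integral_cong_AE)
    show "has_bochner_integral E (\<lambda>v. v powr (1 - 1)) (1::real)"
      using has_bochner_E_powr[of 1] by simp
    show "AE v in E. 1 = v powr (1 - 1)"
      using AE_E_pos by eventually_elim simp
  qed auto
  then show "integrable E (\<lambda>v. 1::real)" "(LINT v|E. (1::real)) = 1"
    by (simp_all add: has_bochner_integral_iff)
qed

text \<open>An integrable majorant of the absolute value of \<open>ln\<close>, with exponents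
  written as \<open>a - 1\<close> to match the Gamma integral.\<close>

definition ln_bound :: "real \<Rightarrow> real" where "ln_bound v = v powr (2 - 1) + 2 * v powr (1 / 2 - 1)"

lemma integrable_ln_bound: "integrable E ln_bound"
  unfolding ln_bound_def[abs_def] using has_bochner_E_powr[of 2] has_bochner_E_powr[of "1 / 2"]
  by (intro Bochner_Integration.integrable_add integrable_mult_right) (auto simp: has_bochner_integral_iff)

lemma abs_ln_le:
  assumes "0 < v"
  shows "\<bar>ln v\<bar> \<le> ln_bound v"
proof (cases "1 \<le> v")
  case True
  then have "ln v \<le> v"
    using ln_le_minus_one[of v] by simp
  then show ?thesis
    using True by (simp add: ln_bound_def add_increasing2)
next
  case False
  \<comment> \<open>Applying \<open>ln w \<le> w\<close> to a negative power of \<open>v\<close>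
    keeps the singularity at 0 integrable.\<close>
  have "ln (v powr (- 1 / 2)) \<le> v powr (- 1 / 2)"
    using ln_le_minus_one[of "v powr (- 1 / 2)"] assms by simp
  then have "- ln v \<le> 2 * v powr (- 1 / 2)"
    using assms by (simp add: ln_powr)
  then show ?thesis
    using False assms by (simp add: ln_bound_def add_increasing)
qed

definition B where "B t = (LINT v|E. g (t * v))"

lemma g_scale:
  assumes "0 < t" "0 < v"
  shows "\<bar>g (t * v) - g t\<bar> \<le> ln_bound v"
proof (cases "1 \<le> v")
  case True
  then have "t \<le> t * v"
    using assms by simp
  then have "\<bar>g (t * v) - g t\<bar> \<le> ln v"
    using g_diff_bounds[of t "t * v"] assms by simp
  then show ?thesis
    using abs_ln_le[OF assms(2)] by linarith
next
  case False
  then have "t * v \<le> t"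
    using assms by simp
  then have "\<bar>g (t * v) - g t\<bar> \<le> - ln v"
    using g_diff_bounds[of "t * v" t] assms by (simp add: ln_div)
  then show ?thesis
    using abs_ln_le[OF assms(2)] by linarith
qed

lemma integrable_g:
  assumes t: "0 < t"
  shows "integrable E (\<lambda>v. g (t * v))"
proof (rule Bochner_Integration.integrable_bound)
  show "integrable E (\<lambda>v. \<bar>g t\<bar> * 1 + ln_bound v)"
    by (intro Bochner_Integration.integrable_add integrable_mult_right integrable_E_1 integrable_ln_bound)
  show "AE v in E. norm (g (t * v)) \<le> norm (\<bar>g t\<bar> * 1 + ln_bound v)"
    using AE_E_pos
  proof eventually_elim
    case (elim v)
    then show ?case
      using g_scale[OF t elim] by simp
  qed
qed simp

lemma B_close:
  assumes t: "0 < t"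
  shows "\<bar>B t - g t\<bar> \<le> (LINT v|E. ln_bound v)"
proof -
  have gt: "integrable E (\<lambda>v. g t * 1)" "(LINT v|E. g t * 1) = g t"
    using integrable_mult_right[OF integrable_E_1, of "g t"]
      Bochner_Integration.integral_mult_right[OF integrable_E_1, of "g t"] integral_E_1 by auto
  have "B t - g t = (LINT v|E. g (t * v) - g t * 1)"
    unfolding B_def using Bochner_Integration.integral_diff[OF integrable_g[OF t] gt(1)] gt(2) by simp
  also have "\<bar>\<dots>\<bar> \<le> (LINT v|E. \<bar>g (t * v) - g t * 1\<bar>)"
    by (rule integral_abs_bound)
  also have "\<dots> \<le> (LINT v|E. ln_bound v)"
  proof (intro integral_mono_AE integrable_ln_bound integrable_abs Bochner_Integration.integrable_diff integrable_g t gt)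
    show "AE v in E. \<bar>g (t * v) - g t * 1\<bar> \<le> ln_bound v"
      using AE_E_pos by eventually_elim (use g_scale[OF t] in simp)
  qed
  finally show ?thesis .
qed

text \<open>The functional equation at \<open>s = n / Suc n\<close> after substituting
  \<open>x = Suc n * v\<close>. Writing \<open>f z = exp (z + g z)\<close>, the linear parts leave
  exactly the weight \<open>exp (- v)\<close>.\<close>

lemma integral_exp_g:
  fixes n :: nat
  assumes n: "1 \<le> n"
  shows "has_bochner_integral E (\<lambda>v. exp (- (g (real (Suc n) * v) - g (real n * v)))) (1 - \<beta> / real (Suc n))"
proof -
  define s where "s = real n / real (Suc n)"
  have s: "0 \<le> s" "s < 1" "1 / (1 - s) = real (Suc n)"
    using n by (auto simp: s_def field_simps)
  define w where "w x = indicator {0<..} x / f x * f (s * x)" for x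
  have "has_bochner_integral lborel w (real (Suc n) - \<beta>)"
    using has_bochner_M_f[OF s(1,2)] s(3)
    by (simp add: w_def[abs_def] has_bochner_integral_iff integrable_M integral_M)
  then have "has_bochner_integral lborel (\<lambda>v. w (0 + real (Suc n) * v)) ((real (Suc n) - \<beta>) / real (Suc n))"
    using lborel_integrable_real_affine[of w "real (Suc n)" 0] lborel_integral_real_affine[of "real (Suc n)" w 0]
    by (simp add: has_bochner_integral_iff field_simps del: of_nat_Suc)
  moreover have "w (0 + real (Suc n) * v)
      = indicator {0<..} v * exp (- v) * exp (- (g (real (Suc n) * v) - g (real n * v)))" for v
  proof (cases "0 < v")
    case True
    have f_eq_exp: "f z = exp (z + g z)" if "0 < z" for z
      using f_pos[of z] that by (simp add: g_def)
    have pos: "0 < real (Suc n) * v" "0 < real n * v"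
      using True n by auto
    have "s * (real (Suc n) * v) = real n * v"
      by (simp add: s_def)
    then have "w (0 + real (Suc n) * v) = f (real n * v) / f (real (Suc n) * v)"
      using pos by (simp only: w_def add_0) simp
    also have "\<dots> = exp ((real n * v + g (real n * v)) - (real (Suc n) * v + g (real (Suc n) * v)))"
      unfolding f_eq_exp[OF pos(1)] f_eq_exp[OF pos(2)] exp_diff ..
    also have "\<dots> = exp (- v) * exp (- (g (real (Suc n) * v) - g (real n * v)))"
      by (simp add: exp_add[symmetric] algebra_simps)
    finally show ?thesis
      using True by simp
  next
    case False
    then have "\<not> 0 < real (Suc n) * v"
      by (simp add: zero_less_mult_iff)
    then show ?thesis
      using False by (simp add: w_def)
  qed
  moreover have "(real (Suc n) - \<beta>) / real (Suc n) = 1 - \<beta> / real (Suc n)"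
    by (simp add: field_simps)
  ultimately show ?thesis
    by (simp add: has_bochner_integral_iff integrable_E integral_E del: of_nat_Suc)
qed

text \<open>The increment \<open>y\<close> of \<open>g\<close> lies between 0 and
  \<open>1 / n\<close>, so the known mean of \<open>1 - exp (- y)\<close> nearly determines the mean
  of \<open>y\<close>, via
  \<open>1 - exp (- y) \<le> y \<le> (1 + y) * (1 - exp (- y))\<close>.\<close>

lemma B_step:
  fixes n :: nat
  assumes n: "1 \<le> n"
  shows "\<beta> / real (Suc n) \<le> B (Suc n) - B n" "B (Suc n) - B n \<le> \<beta> / real n"
proof -
  define y where "y v = g (real (Suc n) * v) - g (real n * v)" for v
  have y: "0 \<le> y v" "y v \<le> 1 / real n" if v: "0 < v" for v
  proof -
    have "real n * v \<le> real (Suc n) * v" "0 < real n * v"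
      using v n by auto
    note b = g_diff_bounds[OF this(2,1)]
    show "0 \<le> y v"
      using b(1) by (simp add: y_def)
    have "real (Suc n) * v / (real n * v) = 1 + 1 / real n"
      using v n by (simp add: field_simps)
    then show "y v \<le> 1 / real n"
      using b(2) ln_add_one_self_le_self[of "1 / real n"] by (simp add: y_def)
  qed
  have int_y: "integrable E y" and B_diff: "B (Suc n) - B n = (LINT v|E. y v)"
    unfolding y_def[abs_def] B_def
    using integrable_g[of "real (Suc n)"] integrable_g[of "real n"] n by auto
  have int_e: "integrable E (\<lambda>v. exp (- y v))" and e: "(LINT v|E. exp (- y v)) = 1 - \<beta> / real (Suc n)"
    using integral_exp_g[OF n] by (simp_all add: y_def has_bochner_integral_iff)
  have int_1e: "integrable E (\<lambda>v. 1 - exp (- y v))"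
    by (intro Bochner_Integration.integrable_diff integrable_E_1 int_e)
  have 1: "(LINT v|E. 1 - exp (- y v)) = \<beta> / real (Suc n)"
    unfolding Bochner_Integration.integral_diff[OF integrable_E_1 int_e] integral_E_1 e by simp
  have "(LINT v|E. 1 - exp (- y v)) \<le> (LINT v|E. y v)"
  proof (intro integral_mono int_1e int_y)
    fix v
    show "1 - exp (- y v) \<le> y v"
      using exp_ge_add_one_self[of "- y v"] by linarith
  qed
  then show "\<beta> / real (Suc n) \<le> B (Suc n) - B n"
    using 1 B_diff by simp
  have "(LINT v|E. y v) \<le> (LINT v|E. (1 + 1 / real n) * (1 - exp (- y v)))"
  proof (intro integral_mono_AE integrable_mult_right int_1e int_y)
    show "AE v in E. y v \<le> (1 + 1 / real n) * (1 - exp (- y v))"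
      using AE_E_pos
    proof eventually_elim
      case (elim v)
      have "(1 + y v) * exp (- y v) \<le> exp (y v) * exp (- y v)"
        by (intro mult_right_mono exp_ge_add_one_self) simp
      then have "y v \<le> (1 + y v) * (1 - exp (- y v))"
        by (simp add: exp_add[symmetric] algebra_simps)
      also have "\<dots> \<le> (1 + 1 / real n) * (1 - exp (- y v))"
        using y[OF elim] by (intro mult_right_mono) auto
      finally show ?case .
    qed
  qed
  also have "\<dots> = (1 + 1 / real n) * (\<beta> / real (Suc n))"
    using 1 by simp
  also have "1 + 1 / real n = real (Suc n) / real n"
    using n by (simp add: field_simps)
  also have "real (Suc n) / real n * (\<beta> / real (Suc n)) = \<beta> / real n"
    by simp
  finally show "B (Suc n) - B n \<le> \<beta> / real n"
    using B_diff by simp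
qed

text \<open>Telescoping, with \<open>1 / (n + 1)\<close> bounding the next increment of
  \<open>ln\<close> from above; subtracting \<open>ln 2\<close> makes the case \<open>n = 1\<close>
  an equality.\<close>

lemma B_lower:
  fixes n :: nat
  assumes "1 \<le> n"
  shows "\<beta> * (ln (real (Suc n)) - ln 2) \<le> B n - B 1"
  using assms
proof (induction n rule: dec_induct)
  case (step n)
  have "real (Suc (Suc n)) / real (Suc n) = 1 + 1 / real (Suc n)"
    by (simp add: field_simps)
  then have "ln (real (Suc (Suc n)) / real (Suc n)) \<le> 1 / real (Suc n)"
    using ln_add_one_self_le_self[of "1 / real (Suc n)"] by (simp del: of_nat_Suc)
  then have "ln (real (Suc (Suc n))) - ln (real (Suc n)) \<le> 1 / real (Suc n)"
    by (simp add: ln_div del: of_nat_Suc)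
  then have "\<beta> * (ln (real (Suc (Suc n))) - ln (real (Suc n))) \<le> \<beta> * (1 / real (Suc n))"
    using beta by (intro mult_left_mono) auto
  then show ?case
    using step.IH B_step(1)[of n] step.hyps by (simp add: algebra_simps)
qed simp

text \<open>Telescoping, with \<open>1 / (n + 1)\<close> at most \<open>ln (n + 1) - ln n\<close>;
  the summand 1 accounts for the step from \<open>B 1\<close> to \<open>B 2\<close>.\<close>

lemma B_upper:
  fixes n :: nat
  assumes "1 \<le> n"
  shows "B (Suc n) - B 1 \<le> \<beta> * (1 + ln (real n))"
  using assms
proof (induction n rule: dec_induct)
  case base
  then show ?case
    using B_step(2)[of 1] by simp
next
  case (step n)
  have "ln (real n / real (Suc n)) \<le> real n / real (Suc n) - 1"
    using step.hyps by (intro ln_le_minus_one) auto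
  then have "1 / real (Suc n) \<le> ln (real (Suc n)) - ln (real n)"
    using step.hyps by (simp add: ln_div field_simps)
  then have "\<beta> * (1 / real (Suc n)) \<le> \<beta> * (ln (real (Suc n)) - ln (real n))"
    using beta by (intro mult_left_mono) auto
  then show ?case
    using step.IH B_step(2)[of "Suc n"] by (simp add: algebra_simps)
qed

theorem log_asymptotics:
  obtains C where "\<And>x. 1 \<le> x \<Longrightarrow> \<bar>(ln (f x) - x) - \<beta> * ln x\<bar> \<le> C"
proof -
  define K where "K = (LINT v|E. ln_bound v)"
  \<comment> \<open>\<open>B_upper\<close> concerns \<open>B (Suc n)\<close>, which dominates
    \<open>B n\<close>. The constant 1 covers \<open>\<beta> * ln 2\<close> on one side and \<beta>
    on the other.\<close>
  have nat: "\<bar>g (real n) - \<beta> * ln (real n)\<bar> \<le> K + \<bar>B 1\<bar> + 1" if n: "1 \<le> n" for n :: nat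
  proof -
    have "\<bar>B n - g n\<bar> \<le> K"
      unfolding K_def using n by (intro B_close) simp
    moreover have "B n \<le> B (Suc n)"
      using B_step(1)[OF n] beta by (smt (verit) divide_nonneg_nonneg of_nat_0_le_iff)
    moreover have "\<beta> * ln (real n) \<le> \<beta> * ln (real (Suc n))"
      using beta n by (intro mult_left_mono) auto
    moreover have "\<beta> * ln 2 \<le> 1 * 1"
      using beta ln_2_less_1 by (intro mult_mono) auto
    ultimately show ?thesis
      using B_lower[OF n] B_upper[OF n] beta by (simp add: algebra_simps abs_le_iff) linarith
  qed
  have "\<bar>(ln (f x) - x) - \<beta> * ln x\<bar> \<le> K + \<bar>B 1\<bar> + 3" if x: "1 \<le> x" for x
  proof -
    \<comment> \<open>Passing from \<open>x\<close> to its integer part changes \<open>g\<close> and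
      \<open>ln\<close> by at most \<open>ln 2 < 1\<close> each, since
      \<open>x \<le> 2 * n\<close>.\<close>
    define n where "n = nat \<lfloor>x\<rfloor>"
    have "real n = of_int \<lfloor>x\<rfloor>" "1 \<le> \<lfloor>x\<rfloor>"
      using x by (simp_all add: n_def le_floor_iff)
    then have n: "1 \<le> n" "real n \<le> x" "x \<le> 2 * real n"
      by linarith+
    have "ln (x / real n) \<le> ln 2"
      using n by (intro ln_mono) (auto simp: field_simps)
    then have d: "0 \<le> g x - g n" "g x - g n \<le> 1" "0 \<le> ln x - ln n" "ln x - ln n \<le> 1"
      using g_diff_bounds[of "real n" x] n x ln_2_less_1 by (auto simp: ln_div)
    have "0 \<le> \<beta> * (ln x - ln n)" "\<beta> * (ln x - ln n) \<le> 1"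
      using beta d mult_mono[of \<beta> 1 "ln x - ln n" 1] by simp_all
    then show ?thesis
      using nat[OF n(1)] d unfolding g_def[symmetric] by (simp add: algebra_simps abs_le_iff)
  qed
  then show ?thesis
    using that by blast
qed

end

section \<open>The limit for a series given on the half-line\<close>

theorem theorem1p2:
  fixes \<beta> :: real and c :: "nat \<Rightarrow> real" and f :: "real \<Rightarrow> real"
  assumes beta: "0 \<le> \<beta>" "\<beta> < 1"
    and series: "\<And>x. x \<ge> 0 \<Longrightarrow> (\<lambda>i. c i * x ^ i) sums f x"
    and f0: "f 0 = 1"
    and inteq: "\<And>s. 0 \<le> s \<Longrightarrow> s < 1 \<Longrightarrow>
       ((\<lambda>x. f (s * x) / f x) has_integral (1 / (1 - s) - \<beta>)) {0..}"
  shows "\<exists>L::real. ((\<lambda>x. (ln (f x) - x) / ln x) \<longlongrightarrow> L) at_top"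
proof -
  \<comment> \<open>Convergence at all positive points gives convergence everywhere; the sum
    \<open>F\<close> extends \<open>f\<close> from the half-line to the reals.\<close>
  define F where "F x = (\<Sum>i. c i * x ^ i)" for x
  have F_sums: "(\<lambda>i. c i * x ^ i) sums F x" for x
  proof -
    have "summable (\<lambda>i. norm (c i * x ^ i))"
      using series[of "\<bar>x\<bar> + 1"] by (intro powser_insidea[of c "\<bar>x\<bar> + 1"]) (auto simp: sums_iff)
    then show ?thesis
      unfolding F_def by (rule summable_sums[OF summable_norm_cancel])
  qed
  have F_eq: "F x = f x" if "0 \<le> x" for x
    using F_sums series[OF that] by (rule sums_unique2)
  interpret F: balanced_series \<beta> c F
  proof
    fix s :: real assume s: "0 \<le> s" "s < 1"
    show "((\<lambda>x. F (s * x) / F x) has_integral (1 / (1 - s) - \<beta>)) {0..}"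
      by (rule has_integral_eq[OF _ inteq[OF s]]) (use s in \<open>simp add: F_eq\<close>)
  qed (use beta F_sums F_eq f0 in auto)
  obtain C where C: "\<And>x. 1 \<le> x \<Longrightarrow> \<bar>(ln (F x) - x) - \<beta> * ln x\<bar> \<le> C"
    using F.log_asymptotics by blast
  \<comment> \<open>The limit is \<beta>: the bounded error disappears after division by
    \<open>ln x\<close>.\<close>
  have "((\<lambda>x. (ln (f x) - x) / ln x - \<beta>) \<longlongrightarrow> 0) at_top"
  proof (rule Lim_null_comparison)
    show "eventually (\<lambda>x. norm ((ln (f x) - x) / ln x - \<beta>) \<le> C / ln x) at_top"
      using eventually_gt_at_top[of 1]
    proof eventually_elim
      case (elim x)
      then have "(ln (f x) - x) / ln x - \<beta> = ((ln (F x) - x) - \<beta> * ln x) / ln x"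
        by (simp add: F_eq field_simps)
      moreover have "norm \<dots> \<le> C / ln x"
        using C[of x] elim by (simp add: divide_right_mono)
      ultimately show ?case
        by simp
    qed
    show "((\<lambda>x::real. C / ln x) \<longlongrightarrow> 0) at_top"
      by (intro tendsto_divide_0[OF tendsto_const] filterlim_at_top_imp_at_infinity ln_at_top)
  qed
  then have "((\<lambda>x. (ln (f x) - x) / ln x) \<longlongrightarrow> \<beta>) at_top"
    by (simp add: LIM_zero_iff)
  then show ?thesis ..
qed

end
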